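(* Let $D$ be a skew diagram. The skew Schur function $s_D$ is $p$-positive if and only if $D$ is a horizontal strip.
   Context: A partition $\lambda=(\lambda_1,\ldots,\lambda_\ell)$ of $n$ (written $\lambda\vdash n$) is a weakly decreasing list of positive integers with sum $n$; $\emptyset$ is the empty partition of $0$. The diagram of $\lambda$, also denoted $\lambda$, is the left-justified array of boxes with $\lambda_i$ boxes in row $i$, rows numbered top to bottom and columns left to right; box $(i,j)$ is in row $i$, column $j$. For partitions $\lambda=(\lambda_1,\ldots,\lambda_\ell)$ and $\mu=(\mu_1,\ldots,\mu_k)$ with $k\le \ell$ and $\mu_i\le\lambda_i$ for $1\le i\le k$, the skew diagram $\lambda/\mu$ is the set of boxes $\{(i,j) : (i,j)\in\lambda,\ (i,j)\notin\mu\}$, and its size $|\lambda/\mu|$ is its number of boxes. A skew diagram is a horizontal strip if no two of its boxes lie in the same column. A semistandard Young tableau (SSYT) of shape a skew diagram $D$ is a filling of the boxes of $D$ with positive integers weakly increasing from left to right along each row and strictly increasing from top to bottom down each column. Its content is $(c_1,c_2,\ldots)$, where $c_i$ is the number of entries equal to $i$ (listed up to the largest entry). Symmetric functions are in variables $x_1,x_2,\ldots$ over $\mathbb{C}$. For $\lambda=(\lambda_1,\ldots,\lambda_\ell)\vdash n\ge1$, the monomial symmetric function $m_\lambda$ is the sum of all distinct monomials $x_{i_1}^{\lambda_1}\cdots x_{i_\ell}^{\lambda_\ell}$ with $i_1,\ldots,i_\ell$ distinct. The power sum symmetric functions are $p_r=m_{(r)}$ for $r \geq 1$ and $p_\lambda=p_{\lambda_1}\cdots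 p_{\lambda_\ell}$. The Schur function is $s_\lambda=\sum_{\mu\vdash n}K_{\lambda\mu}m_\mu$, where $K_{\lambda\mu}$ is the number of SSYTs of shape $\lambda$ and content $\mu$. By convention $m_\emptyset=p_\emptyset=s_\emptyset=1$. The skew Schur function of a skew diagram $D$ is $s_D=\sum_{\nu\vdash |D|}c_{D\nu}s_\nu$, where $c_{D\nu}$ is the number of SSYTs of shape $D$ and content $\nu$ such that, when the entries are read from right to left in each row, rows from top to bottom, at every stage and for all $i\ge1$ the number of $i$'s read so far is at least the number of $(i+1)$'s read so far. The $p_\lambda$ ($\lambda\vdash n$) form a basis of the homogeneous symmetric functions of degree $n$. A symmetric function is $p$-positive if it is a positive linear combination of power sum symmetric functions $p_\lambda$, that is, all coefficients in its expansion in the basis $\{p_\lambda\}$ are nonnegative real numbers. *)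

theory Defs
  imports Complex_Main "HOL-Library.Poly_Mapping" "HOL-Library.Nonpos_Ints"
begin

section \<open>Partitions and skew diagrams\<close>

definition is_partition :: "nat list \<Rightarrow> bool" where
  "is_partition la \<longleftrightarrow> sorted_wrt (\<ge>) la \<and> (\<forall>r \<in> set la. 0 < r)"

definition partitions_of :: "nat \<Rightarrow> nat list set" where
  "partitions_of n = {la. is_partition la \<and> sum_list la = n}"

text \<open>A box is a pair (row, column); both are numbered from 0, and part number \<open>i + 1\<close> of a
  partition is \<open>la ! i\<close>.\<close>

definition diagram :: "nat list \<Rightarrow> (nat \<times> nat) set" where
  "diagram la = {(i, j). i < length la \<and> j < la ! i}"

definition skew_diagram :: "(nat \<times> nat) set \<Rightarrow> bool" where
  "skew_diagram D \<longleftrightarrow>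
     (\<exists>la mu. is_partition la \<and> is_partition mu \<and> length mu \<le> length la \<and>
        (\<forall>i < length mu. mu ! i \<le> la ! i) \<and> D = diagram la - diagram mu)"

definition horizontal_strip :: "(nat \<times> nat) set \<Rightarrow> bool" where
  "horizontal_strip D \<longleftrightarrow> (\<forall>i i' j. (i, j) \<in> D \<and> (i', j) \<in> D \<longrightarrow> i = i')"


section \<open>Semistandard tableaux\<close>

text \<open>A filling is a total function; requiring it to be 0 outside the shape makes fillings of the
  shape and functions correspond one-to-one, so that tableaux can be counted.\<close>

definition ssyt :: "(nat \<times> nat) set \<Rightarrow> (nat \<times> nat \<Rightarrow> nat) \<Rightarrow> bool" where
  "ssyt D T \<longleftrightarrow>
     (\<forall>b \<in> D. 0 < T b) \<and> (\<forall>b. b \<notin> D \<longrightarrow> T b = 0) \<and>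
     (\<forall>i j j'. (i, j) \<in> D \<and> (i, j') \<in> D \<and> j < j' \<longrightarrow> T (i, j) \<le> T (i, j')) \<and>
     (\<forall>i i' j. (i, j) \<in> D \<and> (i', j) \<in> D \<and> i < i' \<longrightarrow> T (i, j) < T (i', j))"

text \<open>The 0 only provides the maximum over the empty shape, whose content is the empty list.\<close>

definition ssyt_content :: "(nat \<times> nat) set \<Rightarrow> (nat \<times> nat \<Rightarrow> nat) \<Rightarrow> nat list" where
  "ssyt_content D T = map (\<lambda>k. card {b \<in> D. T b = k}) [1..<Suc (Max (insert 0 (T ` D)))]"

definition kostka :: "nat list \<Rightarrow> nat list \<Rightarrow> nat" where
  "kostka la mu = card {T. ssyt (diagram la) T \<and> ssyt_content (diagram la) T = mu}"

definition reading_word :: "(nat \<times> nat) set \<Rightarrow> (nat \<times> nat \<Rightarrow> nat) \<Rightarrow> nat list" where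
  "reading_word D T =
     concat (map (\<lambda>i. map (\<lambda>j. T (i, j)) (rev (sorted_list_of_set {j. (i, j) \<in> D})))
       (sorted_list_of_set (fst ` D)))"

definition lattice_word :: "nat list \<Rightarrow> bool" where
  "lattice_word w \<longleftrightarrow>
     (\<forall>k \<le> length w. \<forall>i \<ge> 1. count_list (take k w) (i + 1) \<le> count_list (take k w) i)"

definition lr_coeff :: "(nat \<times> nat) set \<Rightarrow> nat list \<Rightarrow> nat" where
  "lr_coeff D nu =
     card {T. ssyt D T \<and> ssyt_content D T = nu \<and> lattice_word (reading_word D T)}"


section \<open>Symmetric functions\<close>

text \<open>Symmetric functions are represented as formal power series in the variables
  \<open>x\<^sub>1, x\<^sub>2, \<dots>\<close>, each given by its coefficients. A monomial is a finitely supported exponent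
  vector, whose value at \<open>i\<close> is the exponent of the variable \<open>x\<^bsub>i+1\<^esub>\<close>.\<close>

type_synonym series = "(nat \<Rightarrow>\<^sub>0 nat) \<Rightarrow> complex"

definition one_series :: series where
  "one_series a = (if a = 0 then 1 else 0)"

definition mult_series :: "series \<Rightarrow> series \<Rightarrow> series" where
  "mult_series f g a = (\<Sum>(b, c) \<in> {(b, c). b + c = a}. f b * g c)"

text \<open>Distinct monomials: every monomial of the stated form has coefficient 1, however many
  index lists produce it.\<close>

definition monomial_sym :: "nat list \<Rightarrow> series" where
  "monomial_sym la a =
     (if \<exists>js. length js = length la \<and> distinct js \<and>
             a = (\<Sum>k < length la. Poly_Mapping.single (js ! k) (la ! k))
      then 1 else 0)"

definition power_sum :: "nat list \<Rightarrow> series" where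
  "power_sum la = foldr (\<lambda>r. mult_series (monomial_sym [r])) la one_series"

definition schur :: "nat list \<Rightarrow> series" where
  "schur la a = (\<Sum>mu \<in> partitions_of (sum_list la). of_nat (kostka la mu) * monomial_sym mu a)"

definition skew_schur :: "(nat \<times> nat) set \<Rightarrow> series" where
  "skew_schur D a = (\<Sum>nu \<in> partitions_of (card D). of_nat (lr_coeff D nu) * schur nu a)"

definition p_positive :: "series \<Rightarrow> bool" where
  "p_positive f \<longleftrightarrow>
     (\<exists>S c. finite S \<and> (\<forall>la \<in> S. is_partition la \<and> c la \<in> \<real>\<^sub>\<ge>\<^sub>0) \<and>
        f = (\<lambda>a. \<Sum>la \<in> S. c la * power_sum la a))"


section \<open>The sets that are summed over or counted are finite\<close>

lemma finite_partitions_of: "finite (partitions_of n)"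
proof (rule finite_subset)
  have "length la \<le> sum_list la" if "\<forall>r \<in> set la. 0 < r" for la :: "nat list"
    using that by (induction la) fastforce+
  then show "partitions_of n \<subseteq> {la. set la \<subseteq> {..n} \<and> length la \<le> n}"
    using member_le_sum_list by (fastforce simp: partitions_of_def is_partition_def)
  show "finite {la. set la \<subseteq> {..n} \<and> length la \<le> n}"
    by (rule finite_lists_length_le) simp
qed

lemma finite_diagram: "finite (diagram la)"
  by (rule finite_subset[of _ "SIGMA i:{..<length la}. {..<la ! i}"]) (auto simp: diagram_def)

lemma finite_skew_diagram: "skew_diagram D \<Longrightarrow> finite D"
  by (auto simp: skew_diagram_def finite_diagram)

lemma finite_ssyt_content:
  assumes "finite D"
  shows "finite {T. ssyt D T \<and> ssyt_content D T = mu}"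
proof (rule finite_subset)
  have "T b \<le> length (ssyt_content D T)" if "b \<in> D" for T b
  proof -
    have "T b \<le> Max (insert 0 (T ` D))"
      using assms that by (intro Max_ge) auto
    then show ?thesis
      by (simp add: ssyt_content_def del: upt_Suc)
  qed
  then show "{T. ssyt D T \<and> ssyt_content D T = mu} \<subseteq>
      {T. \<forall>b. (b \<in> D \<longrightarrow> T b \<in> {..length mu}) \<and> (b \<notin> D \<longrightarrow> T b = 0)}"
    unfolding ssyt_def by blast
  show "finite {T. \<forall>b. (b \<in> D \<longrightarrow> T b \<in> {..length mu}) \<and> (b \<notin> D \<longrightarrow> T b = (0 :: nat))}"
    by (rule finite_set_of_finite_funs) (use assms in auto)
qed

lemma finite_splittings:
  fixes a :: "nat \<Rightarrow>\<^sub>0 nat"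
  shows "finite {(b, c). b + c = a}"
proof -
  let ?F = "{f. \<forall>x. (x \<in> Poly_Mapping.keys a \<longrightarrow> f x \<in> {..Max (range (Poly_Mapping.lookup a))}) \<and>
                (x \<notin> Poly_Mapping.keys a \<longrightarrow> f x = (0 :: nat))}"
  have fin: "finite (range (Poly_Mapping.lookup a))"
    by (rule finite_subset[of _ "insert 0 (Poly_Mapping.lookup a ` Poly_Mapping.keys a)"])
      (auto simp: in_keys_iff)
  have le: "Poly_Mapping.lookup b x \<le> Poly_Mapping.lookup a x" if "b + c = a \<or> c + b = a" for b c x
    using that by (auto simp: lookup_add)
  have in_F: "Poly_Mapping.lookup b \<in> ?F" if "b + c = a \<or> c + b = a" for b c
  proof -
    have "Poly_Mapping.lookup b x \<le> Max (range (Poly_Mapping.lookup a))" for x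
      using le[OF that] Max_ge[OF fin] by (meson order_trans rangeI)
    moreover have "Poly_Mapping.lookup b x = 0" if "x \<notin> Poly_Mapping.keys a" for x
      using le[OF \<open>b + c = a \<or> c + b = a\<close>, of x] that by (simp add: in_keys_iff)
    ultimately show ?thesis by simp
  qed
  have "finite ?F"
    by (rule finite_set_of_finite_funs) auto
  moreover have "inj Poly_Mapping.lookup"
    by (simp add: inj_def lookup_inject)
  ultimately have fin_F: "finite (Poly_Mapping.lookup -` ?F)"
    by (rule finite_vimageI)
  have "{(b, c). b + c = a} \<subseteq> Poly_Mapping.lookup -` ?F \<times> Poly_Mapping.lookup -` ?F"
    using in_F by blast
  then show ?thesis
    by (rule finite_subset) (rule finite_cartesian_product[OF fin_F fin_F])
qed

end

theory Submission
  imports Defs "HOL-Library.Multiset"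
begin

text \<open>In a power sum of degree \<open>n\<close> the monomial \<open>x\<^sub>1\<^sup>n\<close> has coefficient 1, so in a \<open>p\<close>-positive series of
  degree \<open>n\<close> its coefficient is the sum of the coefficients of the \<open>p\<close>-expansion. In \<open>s\<^sub>D\<close> that
  coefficient counts the fillings of \<open>D\<close> by ones, which is 0 unless \<open>D\<close> is a horizontal strip; then
  all coefficients would vanish, although \<open>s\<^sub>D \<noteq> 0\<close> because numbering each column from the top gives
  a Littlewood-Richardson filling.

  Conversely, if \<open>D\<close> is a horizontal strip with row lengths \<open>\<alpha>\<close>, a Littlewood-Richardson filling of
  \<open>D\<close> amounts to a chain of partitions growing by horizontal strips of sizes \<open>\<alpha>\<^sub>1, \<alpha>\<^sub>2, \<dots>\<close>, since the
  lattice condition on a row says precisely that the content grows by a horizontal strip.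
  Semistandard tableaux are also such chains, so the coefficients of \<open>s\<^sub>D\<close> count pairs of chains
  with a common end. Fomin's local rule for adding and removing horizontal strips evaluates this
  number as the coefficient of the product of the complete homogeneous functions \<open>h\<close> indexed by
  \<open>\<alpha>\<close>, and Newton's identity \<open>n h\<^sub>n = \<Sum>\<^sub>k p\<^sub>k h\<^bsub>n-k\<^esub>\<close> makes that product \<open>p\<close>-positive.\<close>

section \<open>Power sums and complete homogeneous functions\<close>

abbreviation exponent :: "(nat \<Rightarrow>\<^sub>0 nat) \<Rightarrow> nat \<Rightarrow> nat" where
  "exponent \<equiv> Poly_Mapping.lookup"

section \<open>Degrees of monomials\<close>

definition mdeg :: "(nat \<Rightarrow>\<^sub>0 nat) \<Rightarrow> nat" where
  "mdeg a = (\<Sum>i\<in>Poly_Mapping.keys a. exponent a i)"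

lemma mdeg_superset:
  assumes "finite S" "Poly_Mapping.keys a \<subseteq> S"
  shows "mdeg a = (\<Sum>i\<in>S. exponent a i)"
  unfolding mdeg_def
  by (rule sum.mono_neutral_left) (use assms in \<open>auto simp: in_keys_iff\<close>)

lemma mdeg_add: "mdeg (a + b) = mdeg a + mdeg b"
proof -
  let ?S = "Poly_Mapping.keys a \<union> Poly_Mapping.keys b"
  have "mdeg (a + b) = (\<Sum>i\<in>?S. exponent (a + b) i)"
    by (rule mdeg_superset) (use keys_add[of a b] in auto)
  also have "\<dots> = (\<Sum>i\<in>?S. exponent a i) + (\<Sum>i\<in>?S. exponent b i)"
    by (simp add: lookup_add sum.distrib)
  also have "\<dots> = mdeg a + mdeg b"
    using mdeg_superset[of ?S a] mdeg_superset[of ?S b] by simp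
  finally show ?thesis .
qed

lemma mdeg_single [simp]: "mdeg (Poly_Mapping.single j k) = k"
  by (simp add: mdeg_def)

lemma mdeg_zero [simp]: "mdeg 0 = 0"
  by (simp add: mdeg_def)

lemma mdeg_eq_0_iff: "mdeg a = 0 \<longleftrightarrow> a = 0"
  by (auto simp: mdeg_def in_keys_iff intro!: poly_mapping_eqI)

lemma mdeg_sum: "finite S \<Longrightarrow> mdeg (\<Sum>i\<in>S. f i) = (\<Sum>i\<in>S. mdeg (f i))"
  by (induction S rule: finite_induct) (auto simp: mdeg_add)

section \<open>The commutative product of formal power series\<close>

lemma mult_series_fst_snd:
  "mult_series f g a = (\<Sum>p\<in>{(b, c). b + c = a}. f (fst p) * g (snd p))"
  by (simp add: mult_series_def case_prod_beta)

lemma mult_series_commute: "mult_series f g = mult_series g f"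
proof
  fix a
  show "mult_series f g a = mult_series g f a"
    unfolding mult_series_def
    by (rule sum.reindex_bij_witness[of _ prod.swap prod.swap]) (auto simp: add.commute)
qed

text \<open>Both sides sum over the triples of exponent vectors with total \<open>a\<close>; the
  reindexing moves the middle vector from one pair to the other.\<close>

lemma mult_series_assoc:
  "mult_series (mult_series f g) h = mult_series f (mult_series g h)"
proof
  fix a :: "nat \<Rightarrow>\<^sub>0 nat"
  let ?S = "\<lambda>a :: nat \<Rightarrow>\<^sub>0 nat. {(b, c). b + c = a}"
  have "mult_series (mult_series f g) h a =
      (\<Sum>p\<in>?S a. \<Sum>q\<in>?S (fst p). f (fst q) * g (snd q) * h (snd p))"
    by (auto simp: mult_series_def case_prod_beta sum_distrib_right intro!: sum.cong)
  also have "\<dots> = (\<Sum>(p, q)\<in>(SIGMA p:?S a. ?S (fst p)). f (fst q) * g (snd q) * h (snd p))"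
    by (rule sum.Sigma) (auto simp: finite_splittings)
  also have "\<dots> = (\<Sum>(p, q)\<in>(SIGMA p:?S a. ?S (snd p)). f (fst p) * g (fst q) * h (snd q))"
    by (rule sum.reindex_bij_witness[of _
          "\<lambda>(p, q). ((fst p + fst q, snd q), (fst p, fst q))"
          "\<lambda>(p, q). ((fst q, snd q + snd p), (snd q, snd p))"]) (auto simp: add.assoc)
  also have "\<dots> = (\<Sum>p\<in>?S a. \<Sum>q\<in>?S (snd p). f (fst p) * g (fst q) * h (snd q))"
    by (rule sum.Sigma[symmetric]) (auto simp: finite_splittings)
  also have "\<dots> = mult_series f (mult_series g h) a"
    by (auto simp: mult_series_def case_prod_beta sum_distrib_left mult.assoc intro!: sum.cong)
  finally show "mult_series (mult_series f g) h a = mult_series f (mult_series g h) a" .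
qed

lemma mult_one_series [simp]: "mult_series one_series f = f"
proof
  fix a
  have "mult_series one_series f a = (\<Sum>p\<in>{(0, a)}. one_series (fst p) * f (snd p))"
    unfolding mult_series_fst_snd
    by (rule sum.mono_neutral_right[OF finite_splittings]) (auto simp: one_series_def split: if_splits)
  then show "mult_series one_series f a = f a"
    by (simp add: one_series_def)
qed

lemma mult_series_left_commute:
  "mult_series f (mult_series g h) = mult_series g (mult_series f h)"
  by (metis mult_series_assoc mult_series_commute)

lemma mult_series_sum_left:
  "mult_series (\<lambda>a. \<Sum>i\<in>S. f i a) g = (\<lambda>a. \<Sum>i\<in>S. mult_series (f i) g a)"
proof
  fix a
  show "mult_series (\<lambda>a. \<Sum>i\<in>S. f i a) g a = (\<Sum>i\<in>S. mult_series (f i) g a)"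
    unfolding mult_series_def case_prod_beta sum_distrib_right by (rule sum.swap)
qed

lemma mult_series_sum_right:
  "mult_series f (\<lambda>a. \<Sum>i\<in>S. g i a) = (\<lambda>a. \<Sum>i\<in>S. mult_series f (g i) a)"
  by (simp add: mult_series_commute[of f] mult_series_sum_left)

lemma mult_series_scale_left:
  "mult_series (\<lambda>a. x * f a) g = (\<lambda>a. x * mult_series f g a)"
  by (auto simp: mult_series_def sum_distrib_left case_prod_beta mult.assoc intro!: sum.cong)

lemma mult_series_scale_right:
  "mult_series f (\<lambda>a. x * g a) = (\<lambda>a. x * mult_series f g a)"
  by (simp add: mult_series_commute[of f] mult_series_scale_left)

lemma monomial_sym_single:
  "monomial_sym [k] a = (if \<exists>j. a = Poly_Mapping.single j k then 1 else 0)"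
proof -
  have "(\<exists>js. length js = length [k] \<and> distinct js \<and>
             a = (\<Sum>i < length [k]. Poly_Mapping.single (js ! i) ([k] ! i))) \<longleftrightarrow>
        (\<exists>j. a = Poly_Mapping.single j k)"
    by (auto simp: length_Suc_conv intro: exI[of _ "[_]"])
  then show ?thesis by (simp only: monomial_sym_def)
qed

lemma single_add_diff:
  "k \<le> exponent a j \<Longrightarrow> Poly_Mapping.single j k + (a - Poly_Mapping.single j k) = a"
  by (rule poly_mapping_eqI) (auto simp: lookup_add lookup_minus lookup_single when_def)

lemma single_eq_single_iff:
  "0 < k \<Longrightarrow> Poly_Mapping.single i k = Poly_Mapping.single j k \<longleftrightarrow> i = (j :: nat)"
  for k :: nat
  by (metis lookup_single_eq lookup_single_not_eq less_irrefl)

text \<open>Only splittings whose first component is the \<open>k\<close>-th power of one variable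
  contribute. As \<open>0 < k\<close>, distinct variables give distinct powers, so each is counted
  once.\<close>

lemma mult_monomial_sym_single:
  assumes "0 < k"
  shows "mult_series (monomial_sym [k]) g a =
    (\<Sum>j | k \<le> exponent a j. g (a - Poly_Mapping.single j k))"
proof -
  let ?s = "\<lambda>j. Poly_Mapping.single j k"
  let ?F = "\<lambda>j. (?s j, a - ?s j)"
  have "mult_series (monomial_sym [k]) g a =
      (\<Sum>p\<in>?F ` {j. k \<le> exponent a j}. monomial_sym [k] (fst p) * g (snd p))"
    unfolding mult_series_fst_snd
  proof (rule sum.mono_neutral_right)
    show "finite {(b, c). b + c = a}" by (rule finite_splittings)
    show "?F ` {j. k \<le> exponent a j} \<subseteq> {(b, c). b + c = a}"
      using single_add_diff by auto
    show "\<forall>p\<in>{(b, c). b + c = a} - ?F ` {j. k \<le> exponent a j}.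
        monomial_sym [k] (fst p) * g (snd p) = 0"
      by (auto simp: monomial_sym_single lookup_add lookup_single image_iff)
  qed
  also have "\<dots> = (\<Sum>j | k \<le> exponent a j. monomial_sym [k] (?s j) * g (a - ?s j))"
  proof (subst sum.reindex)
    show "inj_on ?F {j. k \<le> exponent a j}"
      using assms by (auto simp: inj_on_def single_eq_single_iff)
  qed simp
  also have "\<dots> = (\<Sum>j | k \<le> exponent a j. g (a - ?s j))"
    by (intro sum.cong refl) (auto simp: monomial_sym_single)
  finally show ?thesis .
qed

section \<open>Coefficients of power sums\<close>

lemma power_sum_Nil [simp]: "power_sum [] = one_series"
  by (simp add: power_sum_def)

lemma power_sum_Cons: "power_sum (r # la) = mult_series (monomial_sym [r]) (power_sum la)"
  by (simp add: power_sum_def)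

lemma power_sum_mset_cong:
  assumes "mset la = mset mu"
  shows "power_sum la = power_sum mu"
proof -
  have "fold (\<lambda>r. mult_series (monomial_sym [r])) (rev la) =
      fold (\<lambda>r. mult_series (monomial_sym [r])) (rev mu)"
    by (rule fold_multiset_equiv) (use assms in \<open>auto simp: mult_series_left_commute\<close>)
  then show ?thesis by (simp add: power_sum_def foldr_conv_fold)
qed

text \<open>Homogeneity: each factor \<open>monomial_sym [r]\<close> takes exactly \<open>r\<close>
  off the degree.\<close>

lemma power_sum_eq_0:
  assumes "mdeg a \<noteq> sum_list la" "\<forall>r\<in>set la. 0 < r"
  shows "power_sum la a = 0"
  using assms
proof (induction la arbitrary: a)
  case Nil
  then show ?case by (auto simp: one_series_def)
next
  case (Cons r la)
  have "power_sum la (a - Poly_Mapping.single j r) = 0" if "r \<le> exponent a j" for j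
  proof (rule Cons.IH)
    have "mdeg a = r + mdeg (a - Poly_Mapping.single j r)"
      using single_add_diff[OF that] mdeg_add mdeg_single by metis
    then show "mdeg (a - Poly_Mapping.single j r) \<noteq> sum_list la"
      using Cons.prems by simp
  qed (use Cons.prems in auto)
  then show ?case
    using Cons.prems by (simp add: power_sum_Cons mult_monomial_sym_single)
qed

text \<open>In a power of one variable, every factor has to take its \<open>r\<close> from variable
  0, so there is exactly one way to form the monomial.\<close>

lemma power_sum_single_var:
  assumes "\<forall>r\<in>set la. 0 < r"
  shows "power_sum la (Poly_Mapping.single 0 (sum_list la)) = 1"
  using assms
proof (induction la)
  case Nil
  then show ?case by (simp add: one_series_def)
next
  case (Cons r la)
  have "{j. r \<le> exponent (Poly_Mapping.single 0 (r + sum_list la)) j} = {0}"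
    using Cons.prems by (auto simp: lookup_single when_def)
  then show ?case
    using Cons by (simp add: power_sum_Cons mult_monomial_sym_single single_diff[symmetric])
qed

section \<open>Closure properties of p-positivity\<close>

lemma p_positiveE:
  assumes "p_positive f"
  obtains S c where "finite S" "\<And>la. la \<in> S \<Longrightarrow> is_partition la" "\<And>la. c la \<in> \<real>\<^sub>\<ge>\<^sub>0"
    "f = (\<lambda>a. \<Sum>la\<in>S. c la * power_sum la a)"
proof -
  obtain S c where *: "finite S" "\<forall>la\<in>S. is_partition la \<and> c la \<in> \<real>\<^sub>\<ge>\<^sub>0"
    "f = (\<lambda>a. \<Sum>la\<in>S. c la * power_sum la a)"
    using assms by (auto simp: p_positive_def)
  \<comment> \<open>Setting the coefficients to 0 outside \<open>S\<close> makes their nonnegativity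
    unconditional.\<close>
  show ?thesis
    by (rule that[of S "\<lambda>la. if la \<in> S then c la else 0"]) (use * in \<open>auto intro!: sum.cong\<close>)
qed

lemma p_positive_zero: "p_positive (\<lambda>a. 0)"
  unfolding p_positive_def by (intro exI[of _ "{}"]) simp

text \<open>\<open>p_positive\<close> asks for weakly decreasing index lists, but products arise
  with a new part at the front; sorting repairs this because the factors commute.\<close>

lemma p_positive_power_sum:
  assumes "\<forall>r\<in>set la. 0 < r"
  shows "p_positive (power_sum la)"
proof -
  let ?mu = "rev (sort la)"
  have "is_partition ?mu"
    using assms by (auto simp: is_partition_def sorted_wrt_rev)
  moreover have "power_sum la = power_sum ?mu"
    by (rule power_sum_mset_cong) simp
  ultimately show ?thesis
    unfolding p_positive_def by (intro exI[of _ "{?mu}"] exI[of _ "\<lambda>_. 1"]) auto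
qed

lemma p_positive_add:
  assumes "p_positive f" "p_positive g"
  shows "p_positive (\<lambda>a. f a + g a)"
proof -
  from assms(1) obtain S c where f: "finite S" "\<And>la. la \<in> S \<Longrightarrow> is_partition la" "\<And>la. c la \<in> \<real>\<^sub>\<ge>\<^sub>0"
    "f = (\<lambda>a. \<Sum>la\<in>S. c la * power_sum la a)" by (rule p_positiveE) blast
  from assms(2) obtain S' c' where g: "finite S'" "\<And>la. la \<in> S' \<Longrightarrow> is_partition la" "\<And>la. c' la \<in> \<real>\<^sub>\<ge>\<^sub>0"
    "g = (\<lambda>a. \<Sum>la\<in>S'. c' la * power_sum la a)" by (rule p_positiveE) blast
  let ?c = "\<lambda>la. (if la \<in> S then c la else 0) + (if la \<in> S' then c' la else 0)"
  have "(\<Sum>la\<in>S \<union> S'. ?c la * power_sum la a) = f a + g a" for a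
  proof -
    have "(\<Sum>la\<in>S \<union> S'. (if la \<in> S then c la else 0) * power_sum la a) = f a"
      unfolding f(4) using f(1) g(1) by (intro sum.mono_neutral_cong_right) auto
    moreover have "(\<Sum>la\<in>S \<union> S'. (if la \<in> S' then c' la else 0) * power_sum la a) = g a"
      unfolding g(4) using f(1) g(1) by (intro sum.mono_neutral_cong_right) auto
    ultimately show ?thesis by (simp add: distrib_right sum.distrib)
  qed
  then have "(\<lambda>a. f a + g a) = (\<lambda>a. \<Sum>la\<in>S \<union> S'. ?c la * power_sum la a)" by auto
  moreover have "finite (S \<union> S')" "\<forall>la\<in>S \<union> S'. is_partition la \<and> ?c la \<in> \<real>\<^sub>\<ge>\<^sub>0"
    using f g by (auto intro!: nonneg_Reals_add_I)
  ultimately show ?thesis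
    unfolding p_positive_def by (intro exI[of _ "S \<union> S'"] exI[of _ ?c]) auto
qed

lemma p_positive_sum:
  assumes "\<And>i. i \<in> I \<Longrightarrow> p_positive (f i)"
  shows "p_positive (\<lambda>a. \<Sum>i\<in>I. f i a)"
proof (cases "finite I")
  case True
  from this assms show ?thesis
    by (induction I rule: finite_induct) (auto simp: p_positive_zero p_positive_add)
qed (simp add: p_positive_zero)

lemma p_positive_scale:
  assumes "p_positive f" "x \<in> \<real>\<^sub>\<ge>\<^sub>0"
  shows "p_positive (\<lambda>a. x * f a)"
proof -
  from assms(1) obtain S c where f: "finite S" "\<And>la. la \<in> S \<Longrightarrow> is_partition la" "\<And>la. c la \<in> \<real>\<^sub>\<ge>\<^sub>0"
    "f = (\<lambda>a. \<Sum>la\<in>S. c la * power_sum la a)" by (rule p_positiveE) blast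
  show ?thesis
    unfolding p_positive_def
    by (intro exI[of _ S] exI[of _ "\<lambda>la. x * c la"])
      (use f assms(2) in \<open>auto simp: sum_distrib_left mult.assoc intro!: nonneg_Reals_mult_I\<close>)
qed

lemma p_positive_mult_power_sum:
  assumes "p_positive f" "0 < k"
  shows "p_positive (mult_series (monomial_sym [k]) f)"
proof -
  from assms(1) obtain S c where f: "finite S" "\<And>la. la \<in> S \<Longrightarrow> is_partition la" "\<And>la. c la \<in> \<real>\<^sub>\<ge>\<^sub>0"
    "f = (\<lambda>a. \<Sum>la\<in>S. c la * power_sum la a)" by (rule p_positiveE) blast
  have "mult_series (monomial_sym [k]) f = (\<lambda>a. \<Sum>la\<in>S. c la * power_sum (k # la) a)"
    by (simp add: f(4) mult_series_sum_right mult_series_scale_right power_sum_Cons)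
  then show ?thesis
    using f assms(2) by (auto simp: is_partition_def intro!: p_positive_sum p_positive_scale p_positive_power_sum)
qed

section \<open>Complete homogeneous functions and Newton's identity\<close>

definition hom_sym :: "nat \<Rightarrow> series" where
  "hom_sym n a = (if mdeg a = n then 1 else 0)"

lemma hom_sym_0: "hom_sym 0 = one_series"
  by (auto simp: hom_sym_def one_series_def mdeg_eq_0_iff)

text \<open>Double counting: at a monomial of degree \<open>n\<close>, the term for \<open>k\<close>
  counts the variables with exponent at least \<open>k\<close>, so the sum over \<open>k\<close>
  counts every variable as often as its exponent says. In other degrees both sides vanish.\<close>

lemma hom_sym_newton:
  "of_nat n * hom_sym n a =
    (\<Sum>k\<in>{1..n}. mult_series (monomial_sym [k]) (hom_sym (n - k)) a)"
proof -
  have *: "mult_series (monomial_sym [k]) (hom_sym (n - k)) a =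
      (\<Sum>j\<in>Poly_Mapping.keys a. if k \<le> exponent a j then hom_sym n a else 0)" if k: "k \<in> {1..n}" for k
  proof -
    have "mdeg (a - Poly_Mapping.single j k) = n - k \<longleftrightarrow> mdeg a = n" if "k \<le> exponent a j" for j
    proof -
      have "mdeg a = k + mdeg (a - Poly_Mapping.single j k)"
        using single_add_diff[OF that] mdeg_add mdeg_single by metis
      then show ?thesis using k by auto
    qed
    then have "mult_series (monomial_sym [k]) (hom_sym (n - k)) a =
        (\<Sum>j | k \<le> exponent a j. hom_sym n a)"
      using k by (subst mult_monomial_sym_single) (auto simp: hom_sym_def intro!: sum.cong)
    also have "\<dots> = (\<Sum>j\<in>Poly_Mapping.keys a. if k \<le> exponent a j then hom_sym n a else 0)"
      using k by (intro sum.mono_neutral_cong_left) (auto simp: in_keys_iff)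
    finally show ?thesis .
  qed
  show ?thesis
  proof (cases "mdeg a = n")
    case True
    have "(\<Sum>k\<in>{1..n}. mult_series (monomial_sym [k]) (hom_sym (n - k)) a) =
        (\<Sum>k\<in>{1..n}. \<Sum>j\<in>Poly_Mapping.keys a. if k \<le> exponent a j then 1 else 0)"
      using True by (intro sum.cong refl) (simp only: *, simp add: hom_sym_def cong: if_cong)
    also have "\<dots> = (\<Sum>j\<in>Poly_Mapping.keys a. \<Sum>k\<in>{1..n}. if k \<le> exponent a j then 1 else 0)"
      by (rule sum.swap)
    also have "\<dots> = (\<Sum>j\<in>Poly_Mapping.keys a. of_nat (exponent a j))"
    proof (rule sum.cong[OF refl])
      fix j assume "j \<in> Poly_Mapping.keys a"
      then have "exponent a j \<le> n"
        unfolding True[symmetric] mdeg_def by (intro member_le_sum) auto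
      then have "{1..n} \<inter> {k. k \<le> exponent a j} = {1..exponent a j}" by auto
      then show "(\<Sum>k\<in>{1..n}. if k \<le> exponent a j then 1 else 0) = (of_nat (exponent a j) :: complex)"
        by (simp add: sum.If_cases)
    qed
    also have "\<dots> = of_nat n * hom_sym n a"
      using True by (auto simp: hom_sym_def mdeg_def)
    finally show ?thesis by simp
  next
    case False
    then have "hom_sym n a = 0" by (simp add: hom_sym_def)
    moreover from this have "(\<Sum>k\<in>{1..n}. mult_series (monomial_sym [k]) (hom_sym (n - k)) a) = 0"
      by (intro sum.neutral ballI) (simp only: *, simp)
    ultimately show ?thesis by simp
  qed
qed

text \<open>Newton's identity divided by \<open>n\<close> writes \<open>hom_sym n\<close> as a
  nonnegative combination of power sums times \<open>hom_sym (n - k)\<close> with \<open>k\<close>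
  at least 1, which the induction hypothesis covers.\<close>

lemma p_positive_mult_hom_sym:
  assumes "p_positive f"
  shows "p_positive (mult_series (hom_sym n) f)"
proof (induction n rule: less_induct)
  case (less n)
  show ?case
  proof (cases "n = 0")
    case True
    then show ?thesis using assms by (simp add: hom_sym_0)
  next
    case False
    have "hom_sym n = (\<lambda>a. (1 / of_nat n) *
        (\<Sum>k\<in>{1..n}. mult_series (monomial_sym [k]) (hom_sym (n - k)) a))"
      unfolding hom_sym_newton[symmetric] using False by auto
    then have "mult_series (hom_sym n) f = (\<lambda>a. (1 / of_nat n) *
        (\<Sum>k\<in>{1..n}. mult_series (monomial_sym [k]) (mult_series (hom_sym (n - k)) f) a))"
      by (simp only: mult_series_scale_left mult_series_sum_left mult_series_assoc)
    moreover have "(1 / of_nat n :: complex) \<in> \<real>\<^sub>\<ge>\<^sub>0"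
      using nonneg_Reals_of_real_iff[of "1 / of_nat n", where ?'a = complex] by simp
    moreover have "p_positive (\<lambda>a. \<Sum>k\<in>{1..n}.
        mult_series (monomial_sym [k]) (mult_series (hom_sym (n - k)) f) a)"
      using less False by (intro p_positive_sum p_positive_mult_power_sum) auto
    ultimately show ?thesis
      by (simp only: p_positive_scale)
  qed
qed

definition hom_sym_list :: "nat list \<Rightarrow> series" where
  "hom_sym_list al = foldr (\<lambda>k. mult_series (hom_sym k)) al one_series"

lemma hom_sym_list_simps [simp]:
  "hom_sym_list [] = one_series"
  "hom_sym_list (k # al) = mult_series (hom_sym k) (hom_sym_list al)"
  by (simp_all add: hom_sym_list_def)

lemma p_positive_hom_sym_list: "p_positive (hom_sym_list al)"
proof (induction al)
  case Nil
  then show ?case using p_positive_power_sum[of "[]"] by simp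
qed (simp add: p_positive_mult_hom_sym)

lemma hom_sym_list_eq_0:
  assumes "mdeg a \<noteq> sum_list al"
  shows "hom_sym_list al a = 0"
  using assms
proof (induction al arbitrary: a)
  case Nil
  then show ?case by (auto simp: one_series_def)
next
  case (Cons k al)
  show ?case
    unfolding hom_sym_list_simps mult_series_def
    by (rule sum.neutral) (use Cons in \<open>auto simp: hom_sym_def mdeg_add\<close>)
qed


section \<open>The local rule for horizontal strips\<close>

text \<open>Partitions as weakly decreasing functions padded with zeros: conditions between
  neighbouring rows then need no case distinction on lengths.\<close>

definition parts :: "(nat \<Rightarrow> nat) set" where
  "parts = {f. antimono f \<and> finite {i. f i \<noteq> 0}}"

definition psize :: "(nat \<Rightarrow> nat) \<Rightarrow> nat" where
  "psize f = (\<Sum>i | f i \<noteq> 0. f i)"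

lemma psize_eq:
  assumes "\<And>i. N \<le> i \<Longrightarrow> f i = 0"
  shows "psize f = (\<Sum>i<N. f i)"
proof -
  have "i < N" if "f i \<noteq> 0" for i
    using assms that not_le by metis
  then show ?thesis
    unfolding psize_def by (intro sum.mono_neutral_left) auto
qed

lemma ex_zero_beyond:
  fixes f :: "nat \<Rightarrow> nat"
  assumes "finite {i. f i \<noteq> 0}"
  obtains N where "\<And>i. N \<le> i \<Longrightarrow> f i = 0"
proof -
  obtain N where N: "\<forall>i\<in>{i. f i \<noteq> 0}. i < N"
    using finite_nat_set_iff_bounded[THEN iffD1, OF assms] ..
  have "f i = 0" if "N \<le> i" for i
    using N that by (meson mem_Collect_eq not_le)
  then show ?thesis by (rule that)
qed

lemma partsE:
  assumes "f \<in> parts"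
  obtains N where "\<And>i. N \<le> i \<Longrightarrow> f i = 0"
  using assms ex_zero_beyond[of f] by (auto simp only: parts_def mem_Collect_eq)

lemma partsI:
  assumes "\<And>i. f (Suc i) \<le> f i" "\<And>i. N \<le> i \<Longrightarrow> f i = 0"
  shows "f \<in> parts"
proof -
  have "i < N" if "f i \<noteq> 0" for i
    using assms(2) that not_le by metis
  then have "finite {i. f i \<noteq> 0}"
    by (intro finite_subset[of "{i. f i \<noteq> 0}" "{..<N}"] subsetI) simp_all
  moreover have "antimono f"
    using lift_Suc_antimono_le[of f, OF assms(1)] by (simp add: antimono_def)
  ultimately show ?thesis by (simp add: parts_def)
qed

lemma parts_Suc_le: "f \<in> parts \<Longrightarrow> f (Suc i) \<le> f i"
  by (auto simp: parts_def antimono_def)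

lemma le_psize: "finite {i. f i \<noteq> 0} \<Longrightarrow> f i \<le> psize f"
  unfolding psize_def by (cases "f i = 0") (auto intro!: member_le_sum)

lemma zero_in_parts [simp]: "(\<lambda>_. 0) \<in> parts"
  by (rule partsI[of _ 0]) auto

lemma psize_zero [simp]: "psize (\<lambda>_. 0) = 0"
  by (simp add: psize_def)

text \<open>A nonzero value at \<open>i\<close> forces \<open>i + 1\<close> nonzero values up to
  there, hence a size above \<open>i\<close>. This bounds the supports and makes the later sums over
  partitions finite.\<close>

lemma parts_eq_0_beyond_psize:
  assumes "f \<in> parts" "psize f \<le> i"
  shows "f i = 0"
proof (rule ccontr)
  assume "f i \<noteq> 0"
  then have *: "f j \<ge> 1" if "j \<le> i" for j
    using assms(1) that by (fastforce simp: parts_def dest: antimonoD[of f j i])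
  then have "{..i} \<subseteq> {i. f i \<noteq> 0}" by fastforce
  moreover have "finite {i. f i \<noteq> 0}" using assms(1) by (simp add: parts_def)
  ultimately have "(\<Sum>j\<le>i. f j) \<le> psize f"
    unfolding psize_def by (intro sum_mono2) auto
  moreover have "(\<Sum>j\<le>i. 1) \<le> (\<Sum>j\<le>i. f j)"
    by (rule sum_mono) (use * in auto)
  ultimately show False using assms(2) by simp
qed

lemma finite_parts_le: "finite {f \<in> parts. psize f \<le> n}"
proof (rule finite_subset)
  show "{f \<in> parts. psize f \<le> n} \<subseteq>
      {f. \<forall>i. (i \<in> {..<n} \<longrightarrow> f i \<in> {..n}) \<and> (i \<notin> {..<n} \<longrightarrow> f i = 0)}"
  proof clarify
    fix f i assume f: "f \<in> parts" "psize f \<le> n"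
    then have "f i \<le> n"
      using le_psize[of f i] by (simp add: parts_def)
    then show "(i \<in> {..<n} \<longrightarrow> f i \<in> {..n}) \<and> (i \<notin> {..<n} \<longrightarrow> f i = 0)"
      using f parts_eq_0_beyond_psize[of f i] by simp
  qed
  show "finite {f. \<forall>i. (i \<in> {..<n} \<longrightarrow> f i \<in> {..n}) \<and> (i \<notin> {..<n} \<longrightarrow> f i = (0 :: nat))}"
    by (rule finite_set_of_finite_funs) auto
qed

definition parts_of_size :: "nat \<Rightarrow> (nat \<Rightarrow> nat) set" where
  "parts_of_size n = {f \<in> parts. psize f = n}"

lemma finite_parts_of_size: "finite (parts_of_size n)"
  by (rule finite_subset[OF _ finite_parts_le[of n]]) (auto simp: parts_of_size_def)

text \<open>The two inequalities are interlacing: row \<open>i + 1\<close> of \<open>nu\<close> ends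
  no later than row \<open>i\<close> of \<open>rho\<close>, so no two boxes of
  \<open>nu / rho\<close> share a column.\<close>

definition hstrip :: "nat \<Rightarrow> (nat \<Rightarrow> nat) \<Rightarrow> (nat \<Rightarrow> nat) \<Rightarrow> bool" where
  "hstrip k rho nu \<longleftrightarrow> rho \<in> parts \<and> nu \<in> parts \<and> (\<forall>i. rho i \<le> nu i \<and> nu (Suc i) \<le> rho i) \<and>
     psize nu = psize rho + k"

lemma finite_hstrip_down: "finite {rho. hstrip k rho nu}"
  by (rule finite_subset[OF _ finite_parts_le[of "psize nu"]]) (auto simp: hstrip_def)

lemma finite_hstrip_up: "finite {nu. hstrip k rho nu}"
  by (rule finite_subset[OF _ finite_parts_le[of "psize rho + k"]]) (auto simp: hstrip_def)

lemma hstrip_to_zero: "hstrip k rho (\<lambda>_. 0) \<longleftrightarrow> k = 0 \<and> rho = (\<lambda>_. 0)"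
  by (auto simp: hstrip_def)

lemma psize_shift:
  assumes "f \<in> parts"
  shows "(\<lambda>i. f (Suc i)) \<in> parts" "psize f = f 0 + psize (\<lambda>i. f (Suc i))"
proof -
  from assms obtain N where N: "\<And>i. N \<le> i \<Longrightarrow> f i = 0"
    by (rule partsE) blast
  show "(\<lambda>i. f (Suc i)) \<in> parts"
    by (rule partsI[of _ N]) (use N assms in \<open>auto simp: parts_Suc_le\<close>)
  have "psize f = (\<Sum>i<Suc N. f i)" by (rule psize_eq) (use N in auto)
  also have "\<dots> = f 0 + (\<Sum>i<N. f (Suc i))" by (rule sum.lessThan_Suc_shift)
  also have "(\<Sum>i<N. f (Suc i)) = psize (\<lambda>i. f (Suc i))"
    by (rule psize_eq[symmetric]) (use N in auto)
  finally show "psize f = f 0 + psize (\<lambda>i. f (Suc i))" .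
qed

lemma psize_add:
  assumes "finite {i. f i \<noteq> 0}" "finite {i. g i \<noteq> 0}"
  shows "psize (\<lambda>i. f i + g i) = psize f + psize g"
proof -
  obtain N where "\<And>i. N \<le> i \<Longrightarrow> f i = 0"
    using ex_zero_beyond[OF assms(1)] by blast
  moreover obtain M where "\<And>i. M \<le> i \<Longrightarrow> g i = 0"
    using ex_zero_beyond[OF assms(2)] by blast
  ultimately show ?thesis
    using psize_eq[of "max N M" f] psize_eq[of "max N M" g] psize_eq[of "max N M" "\<lambda>i. f i + g i"]
    by (simp add: sum.distrib)
qed

lemma psize_mono:
  assumes "finite {i. g i \<noteq> 0}" "\<And>i. f i \<le> g i"
  shows "psize f \<le> psize g"
proof -
  obtain N where N: "\<And>i. N \<le> i \<Longrightarrow> g i = 0"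
    using ex_zero_beyond[OF assms(1)] by blast
  moreover have "f i = 0" if "N \<le> i" for i
    using N[OF that] assms(2)[of i] by simp
  ultimately show ?thesis
    using psize_eq[of N f] psize_eq[of N g] assms(2) by (simp add: sum_mono)
qed

text \<open>The partitions \<open>tau\<close> below and the tails \<open>i \<mapsto> nu (Suc i)\<close> of the partitions \<open>nu\<close> above both
  \<open>rho\<close> and \<open>sig\<close> range over the same intervals; reflecting these intervals gives the bijection of
  the local rule, whose remaining parameter is \<open>nu 0 - max (rho 0) (sig 0)\<close>.\<close>

definition toggle :: "(nat \<Rightarrow> nat) \<Rightarrow> (nat \<Rightarrow> nat) \<Rightarrow> (nat \<Rightarrow> nat) \<Rightarrow> nat \<Rightarrow> nat" where
  "toggle rho sig g i = min (rho i) (sig i) + max (rho (Suc i)) (sig (Suc i)) - g i"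

lemma toggle_bounds:
  assumes "\<And>i. max (rho (Suc i)) (sig (Suc i)) \<le> g i" "\<And>i. g i \<le> min (rho i) (sig i)"
  shows "max (rho (Suc i)) (sig (Suc i)) \<le> toggle rho sig g i" "toggle rho sig g i \<le> min (rho i) (sig i)"
    "toggle rho sig g i + g i = min (rho i) (sig i) + max (rho (Suc i)) (sig (Suc i))"
  using assms(1,2)[of i] by (auto simp: toggle_def)

text \<open>The bound keeps the subtraction of natural numbers exact, so the reflection is an
  involution.\<close>

lemma toggle_toggle:
  assumes "\<And>i. g i \<le> min (rho i) (sig i)"
  shows "toggle rho sig (toggle rho sig g) = g"
proof
  fix i show "toggle rho sig (toggle rho sig g) i = g i"
    using assms[of i] unfolding toggle_def by linarith
qed

text \<open>The size identity lets the reflection trade sizes of added strips for sizes of removed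
  ones. It holds because minimum and maximum in a row add up to \<open>rho i + sig i\<close>, while
  the shifted maxima miss just the one of row 0.\<close>

lemma toggle_parts:
  assumes "rho \<in> parts" "sig \<in> parts"
    and "\<And>i. max (rho (Suc i)) (sig (Suc i)) \<le> g i" "\<And>i. g i \<le> min (rho i) (sig i)"
  shows "toggle rho sig g \<in> parts" "g \<in> parts"
    "psize (toggle rho sig g) + psize g + max (rho 0) (sig 0) = psize rho + psize sig"
proof -
  note b = toggle_bounds[of rho sig g, OF assms(3,4)]
  obtain N where N: "\<And>i. N \<le> i \<Longrightarrow> rho i = 0"
    using assms(1) by (rule partsE) blast
  \<comment> \<open>Consecutive intervals do not overlap in their interiors: the upper bound for row
    \<open>i + 1\<close> is at most the lower bound for row \<open>i\<close>, so any choice within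
    them is weakly decreasing.\<close>
  have between: "f \<in> parts" if "\<And>i. max (rho (Suc i)) (sig (Suc i)) \<le> f i" "\<And>i. f i \<le> min (rho i) (sig i)" for f
  proof (rule partsI[of _ N])
    show "f (Suc i) \<le> f i" for i
      using that(1)[of i] that(2)[of "Suc i"] by simp
    show "f i = 0" if "N \<le> i" for i
      using \<open>f i \<le> min (rho i) (sig i)\<close> N[OF that] by simp
  qed
  show g: "g \<in> parts" using assms(3,4) by (rule between)
  show t: "toggle rho sig g \<in> parts" using b(1,2) by (rule between)
  let ?M = "\<lambda>i. max (rho i) (sig i)"
  have M: "?M \<in> parts"
  proof -
    obtain N' where "\<And>i. N' \<le> i \<Longrightarrow> sig i = 0"
      using assms(2) by (rule partsE) blast
    then have "?M i = 0" if "max N N' \<le> i" for i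
      using N that by simp
    then show ?thesis
      using parts_Suc_le[OF assms(1)] parts_Suc_le[OF assms(2)]
      by (intro partsI[of _ "max N N'"] max.mono)
  qed
  have m: "finite {i. min (rho i) (sig i) \<noteq> 0}"
    by (rule finite_subset[of _ "{i. rho i \<noteq> 0}"]) (use assms(1) in \<open>auto simp: parts_def\<close>)
  have "psize (toggle rho sig g) + psize g = psize (\<lambda>i. toggle rho sig g i + g i)"
    using g t by (simp add: psize_add parts_def)
  also have "\<dots> = psize (\<lambda>i. min (rho i) (sig i) + ?M (Suc i))"
    by (simp only: b)
  also have "\<dots> = psize (\<lambda>i. min (rho i) (sig i)) + psize (\<lambda>i. ?M (Suc i))"
    using psize_shift(1)[OF M] m by (intro psize_add) (simp_all only: parts_def mem_Collect_eq)
  finally have "psize (toggle rho sig g) + psize g + ?M 0 = psize (\<lambda>i. min (rho i) (sig i)) + psize ?M"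
    using psize_shift(2)[OF M] by simp
  also have "\<dots> = psize (\<lambda>i. min (rho i) (sig i) + ?M i)"
    using M m by (intro psize_add[symmetric]) (simp_all only: parts_def mem_Collect_eq)
  also have "\<dots> = psize (\<lambda>i. rho i + sig i)"
    by (intro arg_cong[of _ _ psize] ext) simp
  also have "\<dots> = psize rho + psize sig"
    using assms(1,2) by (simp add: psize_add parts_def)
  finally show "psize (toggle rho sig g) + psize g + max (rho 0) (sig 0) = psize rho + psize sig" .
qed

text \<open>Row 0 of \<open>nu\<close> is treated apart since it is bounded only from below; the
  other rows lie in the same intervals as the rows of a partition below \<open>rho\<close> and
  \<open>sig\<close>.\<close>

lemma hstrip_up_iff:
  assumes "rho \<in> parts" "sig \<in> parts"
  shows "hstrip k rho nu \<and> hstrip l sig nu \<longleftrightarrow>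
    nu \<in> parts \<and> max (rho 0) (sig 0) \<le> nu 0 \<and> (\<forall>i. max (rho (Suc i)) (sig (Suc i)) \<le> nu (Suc i)) \<and>
    (\<forall>i. nu (Suc i) \<le> min (rho i) (sig i)) \<and> psize nu = psize rho + k \<and> psize nu = psize sig + l"
proof -
  have "(\<forall>i. rho i \<le> nu i) \<longleftrightarrow> rho 0 \<le> nu 0 \<and> (\<forall>i. rho (Suc i) \<le> nu (Suc i))"
    "(\<forall>i. sig i \<le> nu i) \<longleftrightarrow> sig 0 \<le> nu 0 \<and> (\<forall>i. sig (Suc i) \<le> nu (Suc i))"
    by (metis not0_implies_Suc)+
  then show ?thesis using assms by (auto simp: hstrip_def)
qed

lemma hstrip_down_iff:
  assumes "rho \<in> parts" "sig \<in> parts"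
  shows "hstrip k tau rho \<and> hstrip l tau sig \<longleftrightarrow>
    tau \<in> parts \<and> (\<forall>i. max (rho (Suc i)) (sig (Suc i)) \<le> tau i) \<and>
    (\<forall>i. tau i \<le> min (rho i) (sig i)) \<and> psize rho = psize tau + k \<and> psize sig = psize tau + l"
  using assms by (auto simp: hstrip_def)

lemma parts_case_nat:
  assumes "g \<in> parts" "g 0 \<le> x"
  shows "case_nat x g \<in> parts" "psize (case_nat x g) = x + psize g"
proof -
  obtain N where N: "\<And>i. N \<le> i \<Longrightarrow> g i = 0"
    using assms(1) by (rule partsE) blast
  show *: "case_nat x g \<in> parts"
    by (rule partsI[of _ "Suc N"]) (use assms N parts_Suc_le[OF assms(1)] in \<open>auto split: nat.split\<close>)
  show "psize (case_nat x g) = x + psize g"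
    using psize_shift(2)[OF *] by simp
qed

text \<open>Adding a strip of size \<open>k\<close> and then removing one of size \<open>l\<close>
  is traded for removing \<open>l - j\<close> and then adding \<open>k - j\<close>. The bijection
  fixes the end \<open>sig\<close>, so an arbitrary weight \<open>F\<close> may be carried
  along.\<close>

lemma hstrip_local_rule:
  "(\<Sum>nu | hstrip k rho nu. \<Sum>sig | hstrip l sig nu. F sig) =
   (\<Sum>j\<le>min k l. \<Sum>tau | hstrip (l - j) tau rho. \<Sum>sig | hstrip (k - j) tau sig. F sig)"
   (is "?L = ?R") for F :: "(nat \<Rightarrow> nat) \<Rightarrow> nat"
proof -
  let ?A = "SIGMA nu:{nu. hstrip k rho nu}. {sig. hstrip l sig nu}"
  let ?B = "SIGMA j:{..min k l}. SIGMA tau:{tau. hstrip (l - j) tau rho}. {sig. hstrip (k - j) tau sig}"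
  have L: "?L = (\<Sum>(nu, sig)\<in>?A. F sig)"
    by (rule sum.Sigma) (auto simp: finite_hstrip_down finite_hstrip_up)
  have "?R = (\<Sum>j\<le>min k l. \<Sum>(tau, sig)\<in>(SIGMA tau:{tau. hstrip (l - j) tau rho}. {sig. hstrip (k - j) tau sig}). F sig)"
    by (intro sum.cong refl sum.Sigma) (auto simp: finite_hstrip_down finite_hstrip_up)
  also have "\<dots> = (\<Sum>(j, tau, sig)\<in>?B. F sig)"
    by (rule sum.Sigma) (auto simp: finite_hstrip_down finite_hstrip_up)
  finally have R: "?R = (\<Sum>(j, tau, sig)\<in>?B. F sig)" .
  \<comment> \<open>The forward map stores the excess of the first row in \<open>j\<close> and
    reflects the remaining rows; it lands in \<open>?B\<close> and is undone by reflecting again and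
    putting the first row back.\<close>
  have AB: "(nu 0 - max (rho 0) (sig 0), toggle rho sig (\<lambda>i. nu (Suc i)), sig) \<in> ?B \<and>
      case_nat (max (rho 0) (sig 0) + (nu 0 - max (rho 0) (sig 0)))
        (toggle rho sig (toggle rho sig (\<lambda>i. nu (Suc i)))) = nu"
    if nu: "hstrip k rho nu" "hstrip l sig nu" for nu sig
  proof -
    have p: "rho \<in> parts" "sig \<in> parts" using nu by (auto simp: hstrip_def)
    let ?g = "\<lambda>i. nu (Suc i)" and ?j = "nu 0 - max (rho 0) (sig 0)"
    from nu have *: "nu \<in> parts" "max (rho 0) (sig 0) \<le> nu 0"
      "\<And>i. max (rho (Suc i)) (sig (Suc i)) \<le> ?g i" "\<And>i. ?g i \<le> min (rho i) (sig i)"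
      "psize nu = psize rho + k" "psize nu = psize sig + l"
      using hstrip_up_iff[OF p, of k nu l] by auto
    note t = toggle_parts[OF p, of ?g, OF *(3,4)] toggle_bounds[of rho sig ?g, OF *(3,4)]
    have size: "psize nu = nu 0 + psize ?g" by (rule psize_shift) fact
    \<comment> \<open>The size identity gives these equations over the integers. As the reflected
      partition is no larger than \<open>rho\<close> and \<open>sig\<close>, the differences
      \<open>l - ?j\<close> and \<open>k - ?j\<close> are not truncated.\<close>
    have j: "?j \<le> min k l" "psize rho = psize (toggle rho sig ?g) + (l - ?j)"
      "psize sig = psize (toggle rho sig ?g) + (k - ?j)"
    proof -
      have "psize (toggle rho sig ?g) \<le> psize rho" "psize (toggle rho sig ?g) \<le> psize sig"
        using p t(5) by (auto simp: parts_def intro!: psize_mono)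
      then show "?j \<le> min k l" "psize rho = psize (toggle rho sig ?g) + (l - ?j)"
        "psize sig = psize (toggle rho sig ?g) + (k - ?j)"
        using t(3) size *(2,5,6) by linarith+
    qed
    have "hstrip (l - ?j) (toggle rho sig ?g) rho \<and> hstrip (k - ?j) (toggle rho sig ?g) sig"
      unfolding hstrip_down_iff[OF p] using t j by blast
    moreover have "toggle rho sig (toggle rho sig ?g) = ?g"
      by (rule toggle_toggle) (rule *)
    ultimately show ?thesis
      using j(1) *(2) by (auto simp: fun_eq_iff split: nat.split)
  qed
  have BA: "(case_nat (max (rho 0) (sig 0) + j) (toggle rho sig tau), sig) \<in> ?A \<and>
      toggle rho sig (toggle rho sig tau) = tau"
    if j: "j \<le> min k l" and tau: "hstrip (l - j) tau rho" "hstrip (k - j) tau sig" for j tau sig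
  proof -
    have p: "rho \<in> parts" "sig \<in> parts" using tau by (auto simp: hstrip_def)
    from tau have *: "tau \<in> parts"
      "\<And>i. max (rho (Suc i)) (sig (Suc i)) \<le> tau i" "\<And>i. tau i \<le> min (rho i) (sig i)"
      "psize rho = psize tau + (l - j)" "psize sig = psize tau + (k - j)"
      using hstrip_down_iff[OF p, of "l - j" tau "k - j"] by auto
    note t = toggle_parts[OF p, of tau, OF *(2,3)] toggle_bounds[of rho sig tau, OF *(2,3)]
    let ?nu = "case_nat (max (rho 0) (sig 0) + j) (toggle rho sig tau)"
    have "toggle rho sig tau 0 \<le> max (rho 0) (sig 0) + j"
      using t(5)[of 0] by auto
    note nu = parts_case_nat[OF t(1) this]
    have "psize ?nu = psize rho + k" "psize ?nu = psize sig + l"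
      using nu(2) t(3) *(4,5) j by auto
    then have "hstrip k rho ?nu \<and> hstrip l sig ?nu"
      unfolding hstrip_up_iff[OF p] using nu t by auto
    moreover have "toggle rho sig (toggle rho sig tau) = tau"
      by (rule toggle_toggle) (rule *)
    ultimately show ?thesis by simp
  qed
  have "(\<Sum>(nu, sig)\<in>?A. F sig) = (\<Sum>(j, tau, sig)\<in>?B. F sig)"
    by (rule sum.reindex_bij_witness[of _
          "\<lambda>(j, tau, sig). (case_nat (max (rho 0) (sig 0) + j) (toggle rho sig tau), sig)"
          "\<lambda>(nu, sig). (nu 0 - max (rho 0) (sig 0), toggle rho sig (\<lambda>i. nu (Suc i)), sig)"])
      (use AB BA in \<open>auto split del: if_split\<close>)
  then show ?thesis using L R by simp
qed


section \<open>Chains of horizontal strips\<close>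

text \<open>Counts chains from the empty partition up to \<open>nu\<close>. The head of the list is
  the size of the outermost strip, which is why lists of sizes appear reversed later.\<close>

fun strip_chains :: "nat list \<Rightarrow> (nat \<Rightarrow> nat) \<Rightarrow> nat" where
  "strip_chains [] nu = (if nu = (\<lambda>_. 0) then 1 else 0)"
| "strip_chains (k # al) nu = (\<Sum>rho | hstrip k rho nu. strip_chains al rho)"

text \<open>The exponent lists of the cofactors that remain when a monomial of degree
  \<open>k\<close> is divided out, as in the expansion of a product with
  \<open>hom_sym k\<close>.\<close>

definition lists_below :: "nat \<Rightarrow> nat list \<Rightarrow> nat list set" where
  "lists_below k be = {ga. list_all2 (\<le>) ga be \<and> sum_list ga + k = sum_list be}"

lemma sum_list_le_of_list_all2:
  "list_all2 (\<le>) ga be \<Longrightarrow> sum_list ga \<le> sum_list (be :: nat list)"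
  by (induction rule: list_all2_induct) auto

lemma finite_list_all2_le: "finite {ga. list_all2 (\<le>) ga (be :: nat list)}"
proof (induction be)
  case (Cons l be)
  have "{ga. list_all2 (\<le>) ga (l # be)} \<subseteq> (\<lambda>(x, ga). x # ga) ` ({..l} \<times> {ga. list_all2 (\<le>) ga be})"
    by (auto simp: list_all2_Cons2)
  then show ?case
    using Cons.IH by (rule finite_subset[OF _ finite_imageI[OF finite_cartesian_product[OF finite_atMost]]])
qed simp

lemma finite_lists_below: "finite (lists_below k be)"
  by (rule finite_subset[OF _ finite_list_all2_le[of be]]) (auto simp: lists_below_def)

lemma lists_below_Nil: "lists_below k [] = (if k = 0 then {[]} else {})"
  by (auto simp: lists_below_def)

lemma sum_lists_below_Cons:
  "(\<Sum>ga\<in>lists_below k (l # be). F ga) =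
   (\<Sum>j\<le>min k l. \<Sum>ga\<in>lists_below (k - j) be. F ((l - j) # ga))" for F :: "nat list \<Rightarrow> nat"
proof -
  have "(\<Sum>j\<le>min k l. \<Sum>ga\<in>lists_below (k - j) be. F ((l - j) # ga)) =
      (\<Sum>(j, ga)\<in>(SIGMA j:{..min k l}. lists_below (k - j) be). F ((l - j) # ga))"
    by (rule sum.Sigma) (auto simp: finite_lists_below)
  also have "\<dots> = (\<Sum>ga\<in>lists_below k (l # be). F ga)"
    by (rule sum.reindex_bij_witness[of _ "\<lambda>ga. (l - hd ga, tl ga)" "\<lambda>(j, ga). (l - j) # ga"])
      (auto simp: lists_below_def list_all2_Cons2, (frule sum_list_le_of_list_all2, linarith)+)
  finally show ?thesis ..
qed

text \<open>The added strip is pushed down through the chain by the local rule. Passing a step of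
  size \<open>l\<close>, it loses some \<open>j\<close> and the step shrinks to
  \<open>l - j\<close>; at the empty partition all of \<open>k\<close> must have been used
  up.\<close>

lemma sum_strip_chains_up:
  "(\<Sum>nu | hstrip k rho nu. strip_chains be nu) = (\<Sum>ga\<in>lists_below k be. strip_chains ga rho)"
proof (induction be arbitrary: k rho)
  case Nil
  have "(\<Sum>nu | hstrip k rho nu. strip_chains [] nu) =
      (\<Sum>nu\<in>(if k = 0 \<and> rho = (\<lambda>_. 0) then {\<lambda>_ :: nat. 0 :: nat} else {}). 1)"
    by (rule sum.mono_neutral_cong_right[OF finite_hstrip_up])
      (auto simp: hstrip_to_zero hstrip_def split: if_splits)
  also have "\<dots> = (\<Sum>ga\<in>lists_below k []. strip_chains ga rho)"
    by (simp add: lists_below_Nil)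
  finally show ?case .
next
  case (Cons l be)
  have "(\<Sum>nu | hstrip k rho nu. strip_chains (l # be) nu) =
      (\<Sum>j\<le>min k l. \<Sum>tau | hstrip (l - j) tau rho. \<Sum>sig | hstrip (k - j) tau sig. strip_chains be sig)"
    by (simp add: hstrip_local_rule)
  also have "\<dots> = (\<Sum>j\<le>min k l. \<Sum>tau | hstrip (l - j) tau rho. \<Sum>ga\<in>lists_below (k - j) be. strip_chains ga tau)"
    by (simp add: Cons.IH)
  also have "\<dots> = (\<Sum>j\<le>min k l. \<Sum>ga\<in>lists_below (k - j) be. strip_chains ((l - j) # ga) rho)"
    by (simp, intro sum.cong refl sum.swap)
  also have "\<dots> = (\<Sum>ga\<in>lists_below k (l # be). strip_chains ga rho)"
    by (rule sum_lists_below_Cons[symmetric])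
  finally show ?case .
qed

section \<open>Pairs of chains and complete homogeneous functions\<close>

text \<open>Pairs of chains with a common end. Under the Robinson-Schensted-Knuth correspondence
  they match the nonnegative integer matrices with row sums \<open>al\<close> and column sums
  \<open>be\<close>.\<close>

definition strip_pairing :: "nat list \<Rightarrow> nat list \<Rightarrow> nat" where
  "strip_pairing al be = (\<Sum>nu\<in>parts_of_size (sum_list be). strip_chains al nu * strip_chains be nu)"

text \<open>Peeling the outermost strip off the first chain and exchanging the sums makes
  \<open>nu\<close> range over the partitions above \<open>rho\<close>, where
  \<open>sum_strip_chains_up\<close> applies. If \<open>k\<close> exceeds the size, both sides are
  0.\<close>

lemma strip_pairing_Cons:
  "strip_pairing (k # al) be = (\<Sum>ga\<in>lists_below k be. strip_pairing al ga)"
proof -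
  define n where "n = sum_list be"
  show ?thesis
  proof (cases "k \<le> n")
    case True
    have "strip_pairing (k # al) be =
        (\<Sum>nu\<in>parts_of_size n. \<Sum>rho | hstrip k rho nu. strip_chains al rho * strip_chains be nu)"
      by (simp add: strip_pairing_def sum_distrib_right n_def)
    also have "\<dots> = (\<Sum>(nu, rho)\<in>(SIGMA nu:parts_of_size n. {rho. hstrip k rho nu}).
        strip_chains al rho * strip_chains be nu)"
      by (rule sum.Sigma) (auto simp: finite_parts_of_size finite_hstrip_down)
    also have "\<dots> = (\<Sum>(rho, nu)\<in>(SIGMA rho:parts_of_size (n - k). {nu. hstrip k rho nu}).
        strip_chains al rho * strip_chains be nu)"
      by (rule sum.reindex_bij_witness[of _ prod.swap prod.swap])
        (use True in \<open>auto simp: parts_of_size_def hstrip_def\<close>)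
    also have "\<dots> = (\<Sum>rho\<in>parts_of_size (n - k). \<Sum>nu | hstrip k rho nu. strip_chains al rho * strip_chains be nu)"
      by (rule sum.Sigma[symmetric]) (auto simp: finite_parts_of_size finite_hstrip_up)
    also have "\<dots> = (\<Sum>rho\<in>parts_of_size (n - k). \<Sum>ga\<in>lists_below k be. strip_chains al rho * strip_chains ga rho)"
      by (simp flip: sum_distrib_left add: sum_strip_chains_up)
    also have "\<dots> = (\<Sum>ga\<in>lists_below k be. \<Sum>rho\<in>parts_of_size (n - k). strip_chains al rho * strip_chains ga rho)"
      by (rule sum.swap)
    also have "\<dots> = (\<Sum>ga\<in>lists_below k be. strip_pairing al ga)"
    proof (rule sum.cong[OF refl])
      fix ga assume "ga \<in> lists_below k be"
      then have "sum_list ga = n - k" by (auto simp: lists_below_def n_def)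
      then show "(\<Sum>rho\<in>parts_of_size (n - k). strip_chains al rho * strip_chains ga rho) = strip_pairing al ga"
        by (simp add: strip_pairing_def)
    qed
    finally show ?thesis .
  next
    case False
    then have empty: "lists_below k be = {}"
      by (auto simp: lists_below_def n_def)
    have "{rho. hstrip k rho nu} = {}" if "nu \<in> parts_of_size n" for nu
      using that False by (auto simp: hstrip_def parts_of_size_def)
    then have "strip_pairing (k # al) be = 0"
      by (simp add: strip_pairing_def flip: n_def)
    then show ?thesis using empty by simp
  qed
qed

section \<open>Monomials and their lists of exponents\<close>

definition monom_of :: "nat list \<Rightarrow> nat list \<Rightarrow> (nat \<Rightarrow>\<^sub>0 nat)" where
  "monom_of js la = (\<Sum>k<length la. Poly_Mapping.single (js ! k) (la ! k))"

lemma monom_of_nth: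
  assumes "distinct js" "length js = length la" "m < length la"
  shows "exponent (monom_of js la) (js ! m) = la ! m"
proof -
  have "exponent (monom_of js la) (js ! m) = (\<Sum>k<length la. if k = m then la ! k else 0)"
    unfolding monom_of_def lookup_sum using assms
    by (intro sum.cong) (auto simp: lookup_single when_def nth_eq_iff_index_eq)
  then show ?thesis using assms by simp
qed

lemma monom_of_eq_0: "x \<notin> set js \<Longrightarrow> length js = length la \<Longrightarrow> exponent (monom_of js la) x = 0"
  unfolding monom_of_def lookup_sum
  by (intro sum.neutral) (auto simp: lookup_single when_def)

lemma map_monom_of:
  "distinct js \<Longrightarrow> length js = length la \<Longrightarrow> map (exponent (monom_of js la)) js = la"
  by (auto intro!: nth_equalityI simp: monom_of_nth)

lemma monom_of_map:
  assumes "distinct js" "Poly_Mapping.keys b \<subseteq> set js"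
  shows "monom_of js (map (exponent b) js) = b"
proof (rule poly_mapping_eqI)
  fix x
  show "exponent (monom_of js (map (exponent b) js)) x = exponent b x"
  proof (cases "x \<in> set js")
    case True
    then obtain m where "m < length js" "x = js ! m" by (auto simp: in_set_conv_nth)
    then show ?thesis using assms(1) by (simp add: monom_of_nth)
  next
    case False
    then show ?thesis using assms(2) by (auto simp: monom_of_eq_0 in_keys_iff)
  qed
qed

lemma mdeg_map:
  assumes "distinct js" "Poly_Mapping.keys b \<subseteq> set js"
  shows "mdeg b = sum_list (map (exponent b) js)"
  using assms mdeg_superset[of "set js" b] by (simp add: sum_list_distinct_conv_sum_set)

text \<open>\<open>strip_pairing_Cons\<close> is the rule for multiplying by
  \<open>hom_sym k\<close>: a splitting of \<open>b\<close> with first factor of degree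
  \<open>k\<close> is given by the exponents of the second factor. Since that factor may involve
  fewer variables, \<open>js\<close> is only required to contain those of \<open>b\<close>.\<close>

lemma strip_pairing_eq_hom_sym:
  assumes "distinct js" "Poly_Mapping.keys b \<subseteq> set js"
  shows "of_nat (strip_pairing al (map (exponent b) js)) = hom_sym_list al b"
  using assms(2)
proof (induction al arbitrary: b)
  case Nil
  note deg = mdeg_map[OF assms(1) Nil]
  \<comment> \<open>A chain ending in the empty partition can only have strips of size 0.\<close>
  have chains0: "strip_chains be (\<lambda>_. 0) = (if sum_list be = 0 then 1 else 0)" for be
    by (induction be) (auto simp: hstrip_to_zero cong: conj_cong)
  have "strip_pairing [] (map (exponent b) js) =
     (\<Sum>nu\<in>parts_of_size (mdeg b). if nu = (\<lambda>_. 0) then (if mdeg b = 0 then 1 else 0) else 0)"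
    unfolding strip_pairing_def deg by (intro sum.cong) (auto simp: chains0 simp del: sum_list_eq_0_iff)
  also have "\<dots> = (if b = 0 then 1 else 0)"
    using finite_parts_of_size[of 0] by (auto simp: mdeg_eq_0_iff parts_of_size_def)
  finally show ?case by (simp add: one_series_def)
next
  case (Cons k al)
  let ?S = "{p \<in> {(c, d). c + d = b}. mdeg (fst p) = k}"
  have keys: "Poly_Mapping.keys d \<subseteq> set js" if "c + d = b" for c d
    using that Cons.prems by (auto simp: in_keys_iff lookup_add subset_iff)
  have "hom_sym_list (k # al) b = (\<Sum>p\<in>?S. hom_sym_list al (snd p))"
    unfolding hom_sym_list_simps mult_series_fst_snd
    by (rule sum.mono_neutral_cong_right[OF finite_splittings]) (auto simp: hom_sym_def)
  also have "\<dots> = (\<Sum>p\<in>?S. of_nat (strip_pairing al (map (exponent (snd p)) js)))"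
  proof (rule sum.cong[OF refl])
    fix p assume "p \<in> ?S"
    then have "Poly_Mapping.keys (snd p) \<subseteq> set js" by (intro keys[of "fst p"]) auto
    then show "hom_sym_list al (snd p) = of_nat (strip_pairing al (map (exponent (snd p)) js))"
      by (rule Cons.IH[symmetric])
  qed
  also have "\<dots> = (\<Sum>ga\<in>lists_below k (map (exponent b) js). of_nat (strip_pairing al ga))"
  proof (rule sum.reindex_bij_witness[of _ "\<lambda>ga. (b - monom_of js ga, monom_of js ga)"
        "\<lambda>p. map (exponent (snd p)) js"])
    fix p assume p: "p \<in> ?S"
    obtain c d where cd: "p = (c, d)" "c + d = b" "mdeg c = k" using p by auto
    have kd: "Poly_Mapping.keys d \<subseteq> set js" using keys cd by blast
    have "b - d = c" using cd by auto
    then show "(b - monom_of js (map (exponent (snd p)) js), monom_of js (map (exponent (snd p)) js)) = p"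
      using cd by (simp add: monom_of_map[OF assms(1) kd])
    have "mdeg b = mdeg c + mdeg d" using cd mdeg_add by blast
    then have "sum_list (map (exponent d) js) + k = sum_list (map (exponent b) js)"
      using cd mdeg_map[OF assms(1) kd] mdeg_map[OF assms(1) Cons.prems] by simp
    moreover have "list_all2 (\<le>) (map (exponent d) js) (map (exponent b) js)"
      using cd by (auto simp: list_all2_conv_all_nth lookup_add)
    ultimately show "map (exponent (snd p)) js \<in> lists_below k (map (exponent b) js)"
      using cd by (simp add: lists_below_def)
  next
    fix ga assume "ga \<in> lists_below k (map (exponent b) js)"
    then have le: "list_all2 (\<le>) ga (map (exponent b) js)"
      and sum: "sum_list ga + k = sum_list (map (exponent b) js)" by (auto simp: lists_below_def)
    have len: "length js = length ga" using le by (auto simp: list_all2_lengthD)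
    let ?d = "monom_of js ga"
    show map: "map (exponent (snd (b - ?d, ?d))) js = ga"
      using len assms(1) by (simp add: map_monom_of)
    have "exponent ?d x \<le> exponent b x" for x
    proof (cases "x \<in> set js")
      case True
      then obtain m where "m < length js" "x = js ! m" by (auto simp: in_set_conv_nth)
      then show ?thesis using le len assms(1) by (auto simp: monom_of_nth list_all2_conv_all_nth)
    qed (simp add: monom_of_eq_0 len)
    then have add: "(b - ?d) + ?d = b"
      by (intro poly_mapping_eqI) (simp add: lookup_add lookup_minus)
    have "mdeg ?d = sum_list ga"
      using mdeg_map[OF assms(1) keys[OF add]] map by simp
    then have "mdeg (b - ?d) = k"
      using mdeg_add[of "b - ?d" ?d] sum mdeg_map[OF assms(1) Cons.prems] by (simp add: add)
    then show "(b - ?d, ?d) \<in> ?S" using add by simp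
  qed simp
  also have "\<dots> = of_nat (strip_pairing (k # al) (map (exponent b) js))"
    by (simp add: strip_pairing_Cons)
  finally show ?case ..
qed


section \<open>Semistandard tableaux as chains\<close>

definition row_fun :: "nat list \<Rightarrow> nat \<Rightarrow> nat" where
  "row_fun la i = (if i < length la then la ! i else 0)"

text \<open>Index \<open>k\<close> belongs to the entry \<open>Suc k\<close>, so that contents, like
  partitions, are functions indexed from 0.\<close>

definition fcontent :: "(nat \<times> nat) set \<Rightarrow> (nat \<times> nat \<Rightarrow> nat) \<Rightarrow> nat \<Rightarrow> nat" where
  "fcontent X T k = card {b \<in> X. T b = Suc k}"

lemma
  assumes "ssyt X T"
  shows ssyt_pos: "b \<in> X \<Longrightarrow> 0 < T b"
    and ssyt_outside: "b \<notin> X \<Longrightarrow> T b = 0"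
    and ssyt_row: "(i, j) \<in> X \<Longrightarrow> (i, j') \<in> X \<Longrightarrow> j \<le> j' \<Longrightarrow> T (i, j) \<le> T (i, j')"
    and ssyt_col: "(i, j) \<in> X \<Longrightarrow> (i', j) \<in> X \<Longrightarrow> i < i' \<Longrightarrow> T (i, j) < T (i', j)"
  using assms unfolding ssyt_def le_less by blast+

lemma fcontent_pos:
  assumes "finite X" "b \<in> X" "T b = Suc k"
  shows "0 < fcontent X T k"
proof -
  have "b \<in> {b \<in> X. T b = Suc k}" using assms by simp
  then show ?thesis
    using assms(1) unfolding fcontent_def card_gt_0_iff by (intro conjI) (blast, simp)
qed

lemma tableau_le_length:
  assumes "finite X" "fcontent X T = row_fun mu" "b \<in> X"
  shows "T b \<le> length mu"
proof (rule ccontr)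
  assume "\<not> T b \<le> length mu"
  then obtain k where k: "T b = Suc k" "length mu \<le> k" by (cases "T b") auto
  then show False using fcontent_pos[of X b T k, OF assms(1,3) k(1)] by (simp add: assms(2) row_fun_def)
qed

text \<open>The content list stops at the largest entry, while \<open>fcontent\<close> is padded
  with zeros. Positive parts exclude trailing zeros in \<open>mu\<close>, so its length is recovered
  as the largest entry.\<close>

lemma ssyt_content_eq_iff:
  assumes "finite X" "\<forall>r\<in>set mu. 0 < r"
  shows "ssyt_content X T = mu \<longleftrightarrow> fcontent X T = row_fun mu"
proof -
  define M where "M = Max (insert 0 (T ` X))"
  have le: "T b \<le> M" if "b \<in> X" for b
    unfolding M_def using assms(1) that by (intro Max_ge) auto
  have len: "length (ssyt_content X T) = M"
    by (simp add: ssyt_content_def M_def del: upt_Suc)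
  have nth: "ssyt_content X T ! k = fcontent X T k" if "k < M" for k
    using that by (simp add: ssyt_content_def fcontent_def del: upt_Suc flip: M_def)
  have beyond: "fcontent X T k = 0" if "M \<le> k" for k
  proof -
    have "{b \<in> X. T b = Suc k} = {}" using le that by fastforce
    then show ?thesis by (simp only: fcontent_def card.empty)
  qed
  show ?thesis
  proof
    assume "ssyt_content X T = mu"
    then show "fcontent X T = row_fun mu"
      using len nth beyond by (auto simp: row_fun_def fun_eq_iff)
  next
    assume eq: "fcontent X T = row_fun mu"
    have "M = length mu"
    proof (rule antisym)
      have "T b \<le> length mu" if "b \<in> X" for b
        using tableau_le_length[OF assms(1) eq that] .
      then show "M \<le> length mu"
        unfolding M_def using assms(1) by auto
    next
      show "length mu \<le> M"
      proof (rule ccontr)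
        assume "\<not> length mu \<le> M"
        then have "0 < row_fun mu M" using assms(2) by (simp add: row_fun_def)
        then show False using beyond[of M] eq by simp
      qed
    qed
    then show "ssyt_content X T = mu"
      using len nth eq by (auto intro!: nth_equalityI simp: row_fun_def)
  qed
qed

lemma row_fun_parts:
  assumes "la \<in> partitions_of n"
  shows "row_fun la \<in> parts_of_size n"
proof -
  have sorted: "sorted_wrt (\<ge>) la" and "sum_list la = n"
    using assms by (auto simp: partitions_of_def is_partition_def)
  have "row_fun la \<in> parts"
    by (rule partsI[of _ "length la"])
      (use sorted_wrt_nth_less[OF sorted] in \<open>auto simp: row_fun_def\<close>)
  moreover have "psize (row_fun la) = (\<Sum>i<length la. la ! i)"
    by (subst psize_eq[of "length la"]) (auto simp: row_fun_def)
  ultimately show ?thesis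
    using \<open>sum_list la = n\<close> by (simp add: parts_of_size_def sum_list_sum_nth atLeast0LessThan)
qed

lemma bij_betw_row_fun: "bij_betw row_fun (partitions_of n) (parts_of_size n)"
proof (rule bij_betw_imageI)
  show "inj_on row_fun (partitions_of n)"
  proof (rule inj_onI)
    fix la mu assume *: "la \<in> partitions_of n" "mu \<in> partitions_of n" "row_fun la = row_fun mu"
    have pos: "i < length xs \<longleftrightarrow> row_fun xs i \<noteq> 0" if "xs \<in> partitions_of n" for xs i
      using that by (auto simp: row_fun_def partitions_of_def is_partition_def)
    have "i < length la \<longleftrightarrow> i < length mu" for i
      using pos * by simp
    then have len: "length la = length mu"
      using linorder_neqE_nat by blast
    have "la ! i = mu ! i" if "i < length la" for i
      using fun_cong[OF *(3), of i] that len by (simp add: row_fun_def)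
    then show "la = mu" using len by (intro nth_equalityI)
  qed
  show "row_fun ` partitions_of n = parts_of_size n"
  proof
    show "row_fun ` partitions_of n \<subseteq> parts_of_size n" using row_fun_parts by blast
    show "parts_of_size n \<subseteq> row_fun ` partitions_of n"
    proof
      fix f assume f: "f \<in> parts_of_size n"
      then have anti: "f j \<le> f i" if "i \<le> j" for i j
        using that by (auto simp: parts_of_size_def parts_def antimono_def)
      have fp: "f \<in> parts" "psize f = n" using f by (auto simp: parts_of_size_def)
      obtain N0 where "\<And>i. N0 \<le> i \<Longrightarrow> f i = 0" using fp(1) by (rule partsE) blast
      then have ex: "f N0 = 0" by blast
      \<comment> \<open>The first zero of \<open>f\<close> is the number of parts of the list to be
        found.\<close>
      define N where "N = (LEAST i. f i = 0)"
      have N: "f N = 0" unfolding N_def using ex by (rule LeastI)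
      have pos: "0 < f i" if "i < N" for i
        using that not_less_Least unfolding N_def by blast
      have zero: "f i = 0" if "N \<le> i" for i
        using anti[OF that] N by simp
      let ?la = "map f [0..<N]"
      have row: "row_fun ?la = f"
        by (auto simp: row_fun_def zero fun_eq_iff)
      have "sum_list ?la = psize f"
        by (subst psize_eq[of N]) (auto simp: zero sum_list_sum_nth atLeast0LessThan)
      moreover have "is_partition ?la"
        using pos anti by (auto simp: is_partition_def sorted_wrt_iff_nth_less)
      ultimately have "?la \<in> partitions_of n"
        using fp by (simp add: partitions_of_def)
      then show "f \<in> row_fun ` partitions_of n" using row by (metis imageI)
    qed
  qed
qed

definition ydiag :: "(nat \<Rightarrow> nat) \<Rightarrow> (nat \<times> nat) set" where
  "ydiag f = {(i, j). j < f i}"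

lemma diagram_eq_ydiag: "diagram la = ydiag (row_fun la)"
  by (auto simp: diagram_def ydiag_def row_fun_def split: if_splits)

lemma finite_ydiag:
  assumes "f \<in> parts"
  shows "finite (ydiag f)" "card (ydiag f) = psize f"
proof -
  obtain N where N: "\<And>i. N \<le> i \<Longrightarrow> f i = 0" using assms by (rule partsE) blast
  have "i < N" if "j < f i" for i j
  proof (rule ccontr)
    assume "\<not> i < N"
    then show False using N[of i] that by simp
  qed
  then have eq: "ydiag f = (SIGMA i:{..<N}. {..<f i})"
    by (auto simp: ydiag_def)
  show "finite (ydiag f)" unfolding eq by simp
  show "card (ydiag f) = psize f"
    unfolding eq using psize_eq[of N f, OF N] by simp
qed

lemma finite_tableaux:
  assumes "finite X"
  shows "finite {T. ssyt X T \<and> fcontent X T = row_fun mu}"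
proof (rule finite_subset)
  have "T b \<le> length mu" if "b \<in> X" "fcontent X T = row_fun mu" for T b
    using tableau_le_length assms that by blast
  then show "{T. ssyt X T \<and> fcontent X T = row_fun mu} \<subseteq>
      {T. \<forall>b. (b \<in> X \<longrightarrow> T b \<in> {..length mu}) \<and> (b \<notin> X \<longrightarrow> T b = 0)}"
    unfolding ssyt_def by blast
  show "finite {T. \<forall>b. (b \<in> X \<longrightarrow> T b \<in> {..length mu}) \<and> (b \<notin> X \<longrightarrow> T b = (0 :: nat))}"
    by (rule finite_set_of_finite_funs) (use assms in auto)
qed

text \<open>Serves to describe the small entries of a tableau row by their number alone: rows
  increase weakly, so these entries fill an initial segment.\<close>

lemma downset_eq_lessThan:
  fixes A :: "nat set"
  assumes "finite A" "\<And>i j. j \<in> A \<Longrightarrow> i < j \<Longrightarrow> i \<in> A"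
  shows "A = {..<card A}"
proof (cases "A = {}")
  case False
  have "Max A \<in> A" using assms(1) False by (rule Max_in)
  have "A = {..Max A}"
  proof
    show "A \<subseteq> {..Max A}" using Max_ge[OF assms(1)] by blast
    show "{..Max A} \<subseteq> A" using \<open>Max A \<in> A\<close> assms(2) by (auto simp: le_less)
  qed
  then have "A = {..<Suc (Max A)}" by (simp only: lessThan_Suc_atMost)
  then show ?thesis by (metis card_lessThan)
qed simp

section \<open>Peeling the largest entries off a tableau\<close>

definition tableaux :: "(nat \<Rightarrow> nat) \<Rightarrow> nat list \<Rightarrow> (nat \<times> nat \<Rightarrow> nat) set" where
  "tableaux f mu = {T. ssyt (ydiag f) T \<and> fcontent (ydiag f) T = row_fun mu}"

definition row_trunc :: "nat \<Rightarrow> (nat \<Rightarrow> nat) \<Rightarrow> (nat \<times> nat \<Rightarrow> nat) \<Rightarrow> nat \<Rightarrow> nat" where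
  "row_trunc m f T i = card {j. j < f i \<and> T (i, j) \<le> m}"

definition tab_trunc :: "nat \<Rightarrow> (nat \<times> nat \<Rightarrow> nat) \<Rightarrow> nat \<times> nat \<Rightarrow> nat" where
  "tab_trunc m T b = (if T b \<le> m then T b else 0)"

definition tab_extend :: "nat \<Rightarrow> (nat \<Rightarrow> nat) \<Rightarrow> (nat \<Rightarrow> nat) \<Rightarrow> (nat \<times> nat \<Rightarrow> nat) \<Rightarrow> nat \<times> nat \<Rightarrow> nat" where
  "tab_extend m f g T b = (if b \<in> ydiag f - ydiag g then Suc m else T b)"

lemma row_fun_snoc:
  "row_fun (mu @ [k]) i = (if i = length mu then k else row_fun mu i)"
  by (auto simp: row_fun_def nth_append)

text \<open>Column strictness puts the boxes with the largest allowed entry \<open>m + 1\<close> at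
  the bottoms of their columns, one per column; they form a horizontal strip whose size is the last
  content entry \<open>k\<close>.\<close>

lemma tableaux_trunc:
  assumes f: "f \<in> parts" and T: "T \<in> tableaux f (mu @ [k])"
  defines "m \<equiv> length mu" defines "g \<equiv> row_trunc m f T"
  shows "hstrip k g f" "tab_trunc m T \<in> tableaux g mu" "tab_extend m f g (tab_trunc m T) = T"
proof -
  have ss: "ssyt (ydiag f) T" and cont: "fcontent (ydiag f) T = row_fun (mu @ [k])"
    using T by (auto simp: tableaux_def)
  note fin = finite_ydiag[OF f]
  have le: "T b \<le> Suc m" if "b \<in> ydiag f" for b
    using tableau_le_length[OF fin(1) cont that] by (simp add: m_def)
  have anti: "f j \<le> f i" if "i \<le> j" for i j
    using f that by (auto simp: parts_def antimono_def)
  have "{j. j < f i \<and> T (i, j) \<le> m} = {..<g i}" for i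
    unfolding g_def row_trunc_def
  proof (rule downset_eq_lessThan)
    fix j j' assume "j' \<in> {j. j < f i \<and> T (i, j) \<le> m}" "j < j'"
    moreover from this have "T (i, j) \<le> T (i, j')"
      using ssyt_row[OF ss, of i j j'] by (simp add: ydiag_def)
    ultimately show "j \<in> {j. j < f i \<and> T (i, j) \<le> m}" by auto
  qed auto
  then have g_iff: "j < g i \<longleftrightarrow> j < f i \<and> T (i, j) \<le> m" for i j by blast
  have gf: "g i \<le> f i" for i
    using g_iff[of "f i" i] by simp
  \<comment> \<open>Otherwise the box of row \<open>i\<close> in column \<open>g i\<close> would
    hold \<open>m + 1\<close> and have a box below it, which would need a larger entry.\<close>
  have fg: "f (Suc i) \<le> g i" for i
  proof (rule ccontr)
    assume "\<not> f (Suc i) \<le> g i"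
    then have j: "g i < f (Suc i)" by simp
    then have "g i < f i" using anti[of i "Suc i"] by simp
    then have "T (i, g i) < T (Suc i, g i)"
      using ssyt_col[OF ss, of i "g i" "Suc i"] j by (simp add: ydiag_def)
    moreover have "T (Suc i, g i) \<le> Suc m" using le[of "(Suc i, g i)"] j by (simp add: ydiag_def)
    ultimately have "g i < g i" unfolding g_iff[of "g i" i] using \<open>g i < f i\<close> by simp
    then show False by simp
  qed
  obtain N where N: "\<And>i. N \<le> i \<Longrightarrow> f i = 0" using f by (rule partsE) blast
  have gz: "g i = 0" if "N \<le> i" for i
    using gf[of i] N[OF that] by simp
  have gS: "g (Suc i) \<le> g i" for i
    using gf[of "Suc i"] fg[of i] by simp
  have g: "g \<in> parts" by (rule partsI[of _ N]) (use gS gz in blast)+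
  have dg: "ydiag g = {b \<in> ydiag f. T b \<le> m}"
    by (auto simp: ydiag_def g_iff)
  have "ydiag f = ydiag g \<union> {b \<in> ydiag f. T b = Suc m}"
    using le by (auto simp: dg le_Suc_eq)
  moreover have "ydiag g \<inter> {b \<in> ydiag f. T b = Suc m} = {}"
    by (auto simp: dg)
  moreover have "finite (ydiag g)" "finite {b \<in> ydiag f. T b = Suc m}"
    using fin(1) by (auto simp: dg)
  ultimately have "card (ydiag f) = card (ydiag g) + card {b \<in> ydiag f. T b = Suc m}"
    using card_Un_disjoint by metis
  moreover have "card {b \<in> ydiag f. T b = Suc m} = k"
    using fun_cong[OF cont, of m] by (simp add: fcontent_def row_fun_snoc m_def)
  ultimately have size: "psize f = psize g + k"
    using fin(2) finite_ydiag(2)[OF g] by simp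
  show "hstrip k g f" unfolding hstrip_def using f g gf fg size by blast
  have "ssyt (ydiag g) (tab_trunc m T)"
    using ss unfolding ssyt_def dg tab_trunc_def by auto
  moreover have "fcontent (ydiag g) (tab_trunc m T) i = row_fun mu i" for i
  proof (cases "i < m")
    case True
    then have "{b \<in> ydiag g. tab_trunc m T b = Suc i} = {b \<in> ydiag f. T b = Suc i}"
      by (auto simp: dg tab_trunc_def)
    then show ?thesis
      using True fun_cong[OF cont, of i] by (simp add: fcontent_def row_fun_snoc m_def)
  next
    case False
    then have "{b \<in> ydiag g. tab_trunc m T b = Suc i} = {}"
      by (auto simp: dg tab_trunc_def)
    then show ?thesis
      using False by (simp only: fcontent_def) (simp add: row_fun_def m_def)
  qed
  ultimately show "tab_trunc m T \<in> tableaux g mu"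
    by (auto simp: tableaux_def)
  show "tab_extend m f g (tab_trunc m T) = T"
  proof
    fix b
    show "tab_extend m f g (tab_trunc m T) b = T b"
      using le[of b] ssyt_outside[OF ss, of b]
      by (cases "b \<in> ydiag f") (auto simp: tab_extend_def tab_trunc_def dg le_Suc_eq)
  qed
qed

lemma tableaux_extend:
  assumes gf: "hstrip k g f" and T: "T \<in> tableaux g mu"
  defines "m \<equiv> length mu"
  shows "tab_extend m f g T \<in> tableaux f (mu @ [k])"
    "row_trunc m f (tab_extend m f g T) = g" "tab_trunc m (tab_extend m f g T) = T"
proof -
  have ss: "ssyt (ydiag g) T" and cont: "fcontent (ydiag g) T = row_fun mu"
    using T by (auto simp: tableaux_def)
  have p: "f \<in> parts" "g \<in> parts" and le_gf: "\<And>i. g i \<le> f i" "\<And>i. f (Suc i) \<le> g i"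
    and size: "psize f = psize g + k"
    using gf by (auto simp: hstrip_def)
  have anti: "f j \<le> f i" if "i \<le> j" for i j
    using p that by (auto simp: parts_def antimono_def)
  have le: "T b \<le> m" for b
  proof (cases "b \<in> ydiag g")
    case True
    then show ?thesis
      using tableau_le_length[OF finite_ydiag(1)[OF p(2)] cont] by (simp add: m_def)
  next
    case False
    then show ?thesis using ssyt_outside[OF ss] by simp
  qed
  have T_ne: "T b \<noteq> Suc m" for b using le[of b] by simp
  have sub: "ydiag g \<subseteq> ydiag f"
    using le_gf(1) by (auto simp: ydiag_def intro: less_le_trans)
  let ?T = "tab_extend m f g T"
  have in_g: "?T b = T b" if "b \<in> ydiag g" for b using that by (simp add: tab_extend_def)
  have out_g: "?T b = Suc m" if "b \<in> ydiag f" "b \<notin> ydiag g" for b using that by (simp add: tab_extend_def)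
  have leS: "?T b \<le> Suc m" for b using le[of b] by (simp add: tab_extend_def)
  have "ssyt (ydiag f) ?T"
    unfolding ssyt_def
  proof (intro conjI allI ballI impI; (elim conjE)?)
    fix b assume "b \<in> ydiag f"
    then show "0 < ?T b" using ssyt_pos[OF ss] by (simp add: tab_extend_def)
  next
    fix b assume "b \<notin> ydiag f"
    then show "?T b = 0" using ssyt_outside[OF ss, of b] sub by (auto simp: tab_extend_def)
  next
    fix i j j' assume *: "(i, j) \<in> ydiag f" "(i, j') \<in> ydiag f" "j < j'"
    show "?T (i, j) \<le> ?T (i, j')"
    proof (cases "(i, j') \<in> ydiag g")
      case True
      then have "(i, j) \<in> ydiag g" using * by (auto simp: ydiag_def)
      then show ?thesis using True * ssyt_row[OF ss] by (simp add: in_g)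
    next
      case False
      then show ?thesis using out_g[OF *(2)] leS by simp
    qed
  next
    fix i i' j assume *: "(i, j) \<in> ydiag f" "(i', j) \<in> ydiag f" "i < i'"
    \<comment> \<open>By interlacing, a box with another box of \<open>f\<close> below it already
      lies in \<open>g\<close>, so only the lower of the two can hold the new entry.\<close>
    have "f i' \<le> f (Suc i)" using * by (intro anti) auto
    then have g: "(i, j) \<in> ydiag g" using * le_gf(2)[of i] by (auto simp: ydiag_def)
    show "?T (i, j) < ?T (i', j)"
    proof (cases "(i', j) \<in> ydiag g")
      case True
      then show ?thesis using g * ssyt_col[OF ss] by (simp add: in_g)
    next
      case False
      then show ?thesis using out_g[OF *(2)] in_g[OF g] le[of "(i, j)"] by simp
    qed
  qed
  moreover have "fcontent (ydiag f) ?T i = row_fun (mu @ [k]) i" for i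
  proof (cases "i = m")
    case True
    have "{b \<in> ydiag f. ?T b = Suc i} = ydiag f - ydiag g"
      using sub T_ne by (auto simp: tab_extend_def True)
    then have "fcontent (ydiag f) ?T i = card (ydiag f) - card (ydiag g)"
      using card_Diff_subset[OF finite_ydiag(1)[OF p(2)] sub] by (simp add: fcontent_def)
    then show ?thesis
      using size True finite_ydiag(2)[OF p(1)] finite_ydiag(2)[OF p(2)]
      by (simp add: row_fun_snoc m_def)
  next
    case False
    then have "{b \<in> ydiag f. ?T b = Suc i} = {b \<in> ydiag g. T b = Suc i}"
      using ssyt_outside[OF ss] sub by (auto simp: tab_extend_def)
    then show ?thesis using fun_cong[OF cont, of i] False
      by (simp add: fcontent_def row_fun_snoc m_def)
  qed
  ultimately show "?T \<in> tableaux f (mu @ [k])"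
    by (auto simp: tableaux_def)
  show "row_trunc m f ?T = g"
  proof
    fix i
    have "{j. j < f i \<and> ?T (i, j) \<le> m} = {..<g i}"
      using le le_gf(1)[of i] by (auto simp: tab_extend_def ydiag_def split: if_splits)
    then show "row_trunc m f ?T i = g i" by (simp add: row_trunc_def)
  qed
  show "tab_trunc m ?T = T"
  proof
    fix b
    show "tab_trunc m ?T b = T b"
      using le[of b] ssyt_outside[OF ss, of b] by (auto simp: tab_trunc_def tab_extend_def)
  qed
qed

lemma finite_tableaux_ydiag: "f \<in> parts \<Longrightarrow> finite (tableaux f mu)"
  unfolding tableaux_def by (rule finite_tableaux[OF finite_ydiag(1)])

text \<open>Truncation and extension are mutually inverse, which gives the recursion of
  \<open>strip_chains\<close>. The list is reversed because the largest entry is peeled off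
  first.\<close>

lemma card_tableaux:
  "f \<in> parts \<Longrightarrow> card (tableaux f mu) = strip_chains (rev mu) f"
proof (induction mu arbitrary: f rule: rev_induct)
  case Nil
  have "tableaux f [] = (if f = (\<lambda>_. 0) then {\<lambda>_. 0} else {})"
  proof (cases "f = (\<lambda>_. 0)")
    case True
    then have "ydiag f = {}" by (simp add: ydiag_def)
    then show ?thesis
      using True by (auto simp: tableaux_def ssyt_def fcontent_def row_fun_def)
  next
    case False
    then obtain i where "0 < f i" by (auto simp: fun_eq_iff)
    then have b: "(i, 0) \<in> ydiag f" by (simp add: ydiag_def)
    have "T \<notin> tableaux f []" for T
    proof
      assume T: "T \<in> tableaux f []"
      then have "T (i, 0) \<le> 0"
        using tableau_le_length[OF finite_ydiag(1)[OF Nil], of T "[]"] b by (simp add: tableaux_def)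
      moreover have "0 < T (i, 0)"
        using T b ssyt_pos[of "ydiag f" T "(i, 0)"] by (simp add: tableaux_def)
      ultimately show False by simp
    qed
    then show ?thesis using False by auto
  qed
  then show ?case by simp
next
  case (snoc k mu)
  let ?m = "length mu"
  let ?S = "SIGMA g:{g. hstrip k g f}. tableaux g mu"
  have "bij_betw (\<lambda>T. (row_trunc ?m f T, tab_trunc ?m T)) (tableaux f (mu @ [k])) ?S"
    by (rule bij_betw_byWitness[of _ "\<lambda>(g, T). tab_extend ?m f g T"])
      (auto simp: tableaux_trunc[OF snoc.prems] tableaux_extend)
  then have "card (tableaux f (mu @ [k])) = card ?S"
    by (rule bij_betw_same_card)
  also have "\<dots> = (\<Sum>g | hstrip k g f. card (tableaux g mu))"
    by (rule card_SigmaI[OF finite_hstrip_down]) (auto simp: hstrip_def finite_tableaux_ydiag)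
  also have "\<dots> = (\<Sum>g | hstrip k g f. strip_chains (rev mu) g)"
    by (intro sum.cong refl snoc.IH) (auto simp: hstrip_def)
  finally show ?case by simp
qed

lemma kostka_eq_card:
  assumes "\<forall>r\<in>set mu. 0 < r"
  shows "kostka la mu = card (tableaux (row_fun la) mu)"
  unfolding kostka_def tableaux_def diagram_eq_ydiag[symmetric] ssyt_content_eq_iff[OF finite_diagram assms] ..


section \<open>Littlewood-Richardson tableaux of horizontal strips as chains\<close>

definition above :: "(nat \<times> nat) set \<Rightarrow> nat \<Rightarrow> (nat \<times> nat) set" where
  "above X r = {b \<in> X. fst b < r}"

definition cols :: "(nat \<times> nat) set \<Rightarrow> nat \<Rightarrow> nat set" where
  "cols X r = {j. (r, j) \<in> X}"

lemma finite_cols: "finite X \<Longrightarrow> finite (cols X r)"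
  unfolding cols_def by (rule finite_subset[of _ "snd ` X"]) force+

lemma finite_above: "finite X \<Longrightarrow> finite (above X r)"
  by (simp add: above_def)

lemma above_0: "above X 0 = {}"
  by (simp add: above_def)

lemma above_Suc: "above X (Suc r) = above X r \<union> {r} \<times> cols X r"
  by (auto simp: above_def cols_def less_Suc_eq)

lemma ex_above_eq:
  assumes "finite X"
  obtains r where "above X r = X"
proof -
  have "fst b < Suc (Max (fst ` X))" if "b \<in> X" for b
    using assms that by (simp add: le_imp_less_Suc)
  then have "above X (Suc (Max (fst ` X))) = X" by (auto simp: above_def)
  then show ?thesis by (rule that)
qed

definition row_word :: "(nat \<times> nat) set \<Rightarrow> (nat \<times> nat \<Rightarrow> nat) \<Rightarrow> nat \<Rightarrow> nat list" where
  "row_word X T r = map (\<lambda>j. T (r, j)) (rev (sorted_list_of_set (cols X r)))"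

lemma sorted_list_of_set_insert_greatest:
  assumes "finite A" "\<And>x. x \<in> A \<Longrightarrow> x < r"
  shows "sorted_list_of_set (insert r A) = sorted_list_of_set A @ [r :: nat]"
proof (rule sorted_distinct_set_unique)
  show "sorted (sorted_list_of_set A @ [r])" "distinct (sorted_list_of_set A @ [r])"
    using assms by (auto simp: sorted_append less_imp_le)
  show "set (sorted_list_of_set (insert r A)) = set (sorted_list_of_set A @ [r])"
    using assms(1) set_sorted_list_of_set[of "insert r A"] by simp
qed (rule sorted_sorted_list_of_set distinct_sorted_list_of_set)+

lemma reading_word_above_Suc:
  assumes "finite X"
  shows "reading_word (above X (Suc r)) T = reading_word (above X r) T @ row_word X T r"
proof -
  let ?A = "fst ` above X r"
  have lt: "i < r" if "i \<in> ?A" for i using that by (auto simp: above_def)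
  have row: "{j. (i, j) \<in> above X (Suc r)} = {j. (i, j) \<in> above X r}" if "i < r" for i
    using that by (simp add: above_def less_Suc_eq)
  have fin: "finite ?A" using assms by (simp add: above_def)
  show ?thesis
  proof (cases "cols X r = {}")
    \<comment> \<open>A row without boxes is missing from the list of rows, so nothing changes when
      it is passed.\<close>
    case True
    then have "above X (Suc r) = above X r" by (simp add: above_Suc)
    then show ?thesis using True by (simp add: row_word_def)
  next
    case False
    then have "fst ` above X (Suc r) = insert r ?A"
      by (auto simp: above_Suc image_Un)
    then have "sorted_list_of_set (fst ` above X (Suc r)) = sorted_list_of_set ?A @ [r]"
      using sorted_list_of_set_insert_greatest[OF fin lt] by simp
    moreover have "{j. (r, j) \<in> above X (Suc r)} = cols X r"
      by (auto simp: above_def cols_def)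
    moreover have "map (\<lambda>i. map (\<lambda>j. T (i, j)) (rev (sorted_list_of_set {j. (i, j) \<in> above X (Suc r)})))
          (sorted_list_of_set ?A) =
        map (\<lambda>i. map (\<lambda>j. T (i, j)) (rev (sorted_list_of_set {j. (i, j) \<in> above X r})))
          (sorted_list_of_set ?A)"
    proof (rule map_cong[OF refl])
      fix i assume "i \<in> set (sorted_list_of_set ?A)"
      then have "i < r" using lt fin by simp
      then show "map (\<lambda>j. T (i, j)) (rev (sorted_list_of_set {j. (i, j) \<in> above X (Suc r)})) =
          map (\<lambda>j. T (i, j)) (rev (sorted_list_of_set {j. (i, j) \<in> above X r}))"
        by (simp only: row)
    qed
    ultimately show ?thesis
      unfolding reading_word_def row_word_def by (simp only: map_append concat_append) simp
  qed
qed

lemma count_list_map_distinct: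
  "distinct xs \<Longrightarrow> count_list (map f xs) v = card {x \<in> set xs. f x = v}"
proof (induction xs)
  case (Cons x xs)
  have "{y \<in> set (x # xs). f y = v} =
      (if f x = v then insert x {y \<in> set xs. f y = v} else {y \<in> set xs. f y = v})"
    by auto
  then show ?case using Cons by auto
qed simp

lemma count_row_word:
  "finite X \<Longrightarrow> count_list (row_word X T r) v = card {j \<in> cols X r. T (r, j) = v}"
  by (simp add: row_word_def count_list_map_distinct finite_cols)

lemma fcontent_above_Suc:
  assumes "finite X"
  shows "fcontent (above X (Suc r)) T i =
    fcontent (above X r) T i + card {j \<in> cols X r. T (r, j) = Suc i}"
proof -
  have eq: "{b \<in> above X (Suc r). T b = Suc i} =
      {b \<in> above X r. T b = Suc i} \<union> Pair r ` {j \<in> cols X r. T (r, j) = Suc i}"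
    by (auto simp: above_Suc)
  have "card (Pair r ` {j \<in> cols X r. T (r, j) = Suc i}) = card {j \<in> cols X r. T (r, j) = Suc i}"
    by (rule card_image) (simp add: inj_on_def)
  moreover have "{b \<in> above X r. T b = Suc i} \<inter> Pair r ` {j \<in> cols X r. T (r, j) = Suc i} = {}"
    by (auto simp: above_def)
  ultimately show ?thesis
    unfolding fcontent_def eq using assms finite_cols[OF assms]
    by (subst card_Un_disjoint) (simp_all add: finite_above)
qed

lemma count_reading_word_above:
  assumes "finite X"
  shows "count_list (reading_word (above X r) T) (Suc i) = fcontent (above X r) T i"
proof (induction r)
  case 0
  then show ?case by (simp add: above_0 reading_word_def fcontent_def)
next
  case (Suc r)
  then show ?case
    by (simp add: reading_word_above_Suc[OF assms] fcontent_above_Suc[OF assms] count_row_word[OF assms])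
qed

section \<open>The lattice condition along a weakly decreasing word\<close>

lemma takeWhile_greater_sorted:
  "sorted_wrt (\<ge>) u \<Longrightarrow> takeWhile (\<lambda>x. i < x) u = filter (\<lambda>x. i < x) (u :: nat list)"
proof (induction u)
  case (Cons x u)
  show ?case
  proof (cases "i < x")
    case False
    then have "filter (\<lambda>x. i < x) u = []"
      using Cons.prems by (auto simp: filter_empty_conv)
    then show ?thesis using False by simp
  qed (use Cons in auto)
qed simp

lemma count_list_filter: "count_list (filter P u) x = (if P x then count_list u x else 0)"
  by (induction u) auto

text \<open>In a weakly decreasing \<open>u\<close> every \<open>i + 1\<close> precedes every
  \<open>i\<close>. The critical prefix contains all the \<open>i + 1\<close> of \<open>u\<close>
  and none of its \<open>i\<close>.\<close>

lemma lattice_word_append_sorted: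
  assumes "sorted_wrt (\<ge>) u"
  shows "lattice_word (w @ u) \<longleftrightarrow>
    lattice_word w \<and> (\<forall>i\<ge>1. count_list w (i + 1) + count_list u (i + 1) \<le> count_list w i)"
proof (intro iffI conjI allI impI)
  assume lat: "lattice_word (w @ u)"
  show "lattice_word w"
    unfolding lattice_word_def
  proof (intro allI impI)
    fix k i assume "k \<le> length w" "1 \<le> (i :: nat)"
    then show "count_list (take k w) (i + 1) \<le> count_list (take k w) i"
      using lat[unfolded lattice_word_def, rule_format, of k i] by simp
  qed
  fix i :: nat assume i: "1 \<le> i"
  let ?v = "takeWhile (\<lambda>x. i < x) u"
  have "length ?v \<le> length u" by (rule length_takeWhile_le)
  then have "count_list (take (length w + length ?v) (w @ u)) (i + 1)
      \<le> count_list (take (length w + length ?v) (w @ u)) i"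
    using i by (intro lat[unfolded lattice_word_def, rule_format]) simp_all
  moreover have "take (length w + length ?v) (w @ u) = w @ ?v"
    by (simp flip: takeWhile_eq_take)
  ultimately show "count_list w (i + 1) + count_list u (i + 1) \<le> count_list w i"
    using takeWhile_greater_sorted[OF assms, of i] by (simp add: count_list_filter)
next
  assume *: "lattice_word w \<and> (\<forall>i\<ge>1. count_list w (i + 1) + count_list u (i + 1) \<le> count_list w i)"
  show "lattice_word (w @ u)"
    unfolding lattice_word_def
  proof (intro allI impI)
    fix k i assume k: "k \<le> length (w @ u)" and i: "1 \<le> (i :: nat)"
    show "count_list (take k (w @ u)) (i + 1) \<le> count_list (take k (w @ u)) i"
    proof (cases "k \<le> length w")
      case True
      then show ?thesis using * i by (simp add: lattice_word_def)
    next
      case False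
      let ?v = "take (k - length w) u"
      have "count_list u (i + 1) = count_list ?v (i + 1) + count_list (drop (k - length w) u) (i + 1)"
        by (metis append_take_drop_id count_list_append)
      moreover have "count_list w (i + 1) + count_list u (i + 1) \<le> count_list w i"
        using * i by blast
      ultimately show ?thesis using False by simp
    qed
  qed
qed

lemma sorted_row_word:
  assumes "finite X" "\<forall>j\<in>cols X r. \<forall>j'\<in>cols X r. j \<le> j' \<longrightarrow> T (r, j) \<le> T (r, j')"
  shows "sorted (rev (row_word X T r))"
proof -
  have "sorted (map (\<lambda>j. T (r, j)) (sorted_list_of_set (cols X r)))"
    unfolding sorted_map
    by (rule sorted_wrt_mono_rel[of _ "(\<le>)"])
      (use assms finite_cols[OF assms(1)] in \<open>auto\<close>)
  then show ?thesis by (simp add: row_word_def rev_map)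
qed

lemma ssyt_above_row:
  assumes "ssyt (above X (Suc r)) T"
  shows "\<forall>j\<in>cols X r. \<forall>j'\<in>cols X r. j \<le> j' \<longrightarrow> T (r, j) \<le> T (r, j')"
  using ssyt_row[OF assms, of r] by (simp add: above_Suc)

text \<open>The row is read from right to left and hence weakly decreasing, so the lattice condition need
  only be checked at the end of its block of entries greater than \<open>i\<close>.\<close>

lemma lattice_above_Suc:
  assumes "finite X" "\<forall>j\<in>cols X r. \<forall>j'\<in>cols X r. j \<le> j' \<longrightarrow> T (r, j) \<le> T (r, j')"
  shows "lattice_word (reading_word (above X (Suc r)) T) \<longleftrightarrow>
    lattice_word (reading_word (above X r) T) \<and>
    (\<forall>i. fcontent (above X (Suc r)) T (Suc i) \<le> fcontent (above X r) T i)"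
proof -
  have s: "sorted_wrt (\<ge>) (row_word X T r)"
    using sorted_row_word[OF assms] by (simp add: sorted_wrt_rev)
  have all: "(\<forall>i\<ge>1. P i) \<longleftrightarrow> (\<forall>i. P (Suc i))" for P :: "nat \<Rightarrow> bool"
    by (metis Suc_le_D One_nat_def le_add1 plus_1_eq_Suc)
  show ?thesis
    unfolding reading_word_above_Suc[OF assms(1)] lattice_word_append_sorted[OF s] all
    by (simp add: count_reading_word_above[OF assms(1)] fcontent_above_Suc[OF assms(1)] count_row_word[OF assms(1)])
qed

text \<open>A weakly increasing row exists for any prescribed multiplicities of total
  \<open>card J\<close>: the values in increasing order are matched with the columns in increasing
  order.\<close>

lemma ex_row_filling:
  assumes "finite J" "finite {i. de i \<noteq> 0}" "psize de = card J"
  obtains g :: "nat \<Rightarrow> nat" where "\<And>j. j \<in> J \<Longrightarrow> 0 < g j" "\<And>j. j \<notin> J \<Longrightarrow> g j = 0"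
    "\<And>j j'. j \<in> J \<Longrightarrow> j' \<in> J \<Longrightarrow> j \<le> j' \<Longrightarrow> g j \<le> g j'"
    "\<And>k. card {j \<in> J. g j = Suc k} = de k"
proof -
  obtain N where N: "\<And>i. N \<le> i \<Longrightarrow> de i = 0" using ex_zero_beyond[OF assms(2)] by blast
  define xs where "xs M = concat (map (\<lambda>i. replicate (de i) (Suc i)) [0..<M])" for M
  have set_xs: "x \<le> M \<and> 0 < x" if "x \<in> set (xs M)" for x M
    using that by (auto simp: xs_def)
  have count_xs: "count_list (xs M) (Suc k) = (if k < M then de k else 0)" for M k
  proof (induction M)
    case (Suc M)
    have "count_list (replicate n x) y = (if x = y then n else 0)" for n and x y :: nat
      by (induction n) auto
    then show ?case using Suc by (auto simp: xs_def less_Suc_eq)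
  qed (simp add: xs_def)
  have sorted_xs: "sorted (xs M)" for M
  proof (induction M)
    case (Suc M)
    have "xs (Suc M) = xs M @ replicate (de M) (Suc M)" by (simp add: xs_def)
    moreover have "x \<le> Suc M" if "x \<in> set (xs M)" for x using set_xs[OF that] by simp
    ultimately show ?case using Suc by (auto simp: sorted_append)
  qed (simp add: xs_def)
  define js where "js = sorted_list_of_set J"
  have js: "sorted js" "distinct js" "set js = J" "length js = card J"
    using assms(1) by (auto simp: js_def)
  have len: "length (xs N) = length js"
    using psize_eq[of N de, OF N] assms(3) js(4)
    by (simp add: xs_def length_concat o_def sum_list_sum_nth atLeast0LessThan)
  define g where "g j = (case map_of (zip js (xs N)) j of Some v \<Rightarrow> v | None \<Rightarrow> 0)" for j
  have g_nth: "g (js ! t) = xs N ! t" if "t < length js" for t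
    using that len js(2) by (simp add: g_def map_of_zip_nth)
  then have map_g: "map g js = xs N" using len by (auto intro!: nth_equalityI)
  show ?thesis
  proof (rule that)
    show "0 < g j" if "j \<in> J" for j
      using that map_g js(3) set_xs by (metis image_eqI set_map)
    show "g j = 0" if "j \<notin> J" for j
    proof -
      have "map_of (zip js (xs N)) j = None"
        using that len js(3) by (simp add: map_of_zip_is_None)
      then show ?thesis by (simp add: g_def)
    qed
    show "card {j \<in> J. g j = Suc k} = de k" for k
      using count_list_map_distinct[OF js(2), of g "Suc k"] count_xs[of N k] N[of k]
      unfolding map_g js(3) by (cases "k < N") auto
    show "g j \<le> g j'" if jj: "j \<in> J" "j' \<in> J" "j \<le> j'" for j j'
    proof -
      obtain s t where st: "s < length js" "j = js ! s" "t < length js" "j' = js ! t"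
        using jj js(3) by (metis in_set_conv_nth)
      have "s \<le> t"
      proof (rule ccontr)
        assume "\<not> s \<le> t"
        then have "j' \<le> j" using st js(1) by (simp add: sorted_nth_mono)
        then show False using jj st js(2) \<open>\<not> s \<le> t\<close> by (simp add: nth_eq_iff_index_eq)
      qed
      then show ?thesis using st g_nth sorted_xs[of N] len by (simp add: sorted_nth_mono)
    qed
  qed
qed

text \<open>Reversed, since the bottom row is read last and so contributes the outermost strip of
  the chain.\<close>

definition row_sizes :: "(nat \<times> nat) set \<Rightarrow> nat \<Rightarrow> nat list" where
  "row_sizes X r = rev (map (\<lambda>i. card (cols X i)) [0..<r])"

lemma row_sizes_simps: "row_sizes X 0 = []" "row_sizes X (Suc r) = card (cols X r) # row_sizes X r"
  by (simp_all add: row_sizes_def)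

definition lr_tableaux :: "(nat \<times> nat) set \<Rightarrow> (nat \<Rightarrow> nat) \<Rightarrow> (nat \<times> nat \<Rightarrow> nat) set" where
  "lr_tableaux X c = {T. ssyt X T \<and> fcontent X T = c \<and> lattice_word (reading_word X T)}"

definition restrict_tab :: "(nat \<times> nat) set \<Rightarrow> (nat \<times> nat \<Rightarrow> nat) \<Rightarrow> nat \<times> nat \<Rightarrow> nat" where
  "restrict_tab X T b = (if b \<in> X then T b else 0)"

lemma fcontent_cong: "(\<And>b. b \<in> X \<Longrightarrow> T b = T' b) \<Longrightarrow> fcontent X T = fcontent X T'"
  unfolding fcontent_def by (intro ext arg_cong[of _ _ card] Collect_cong) auto

lemma reading_word_cong:
  assumes "finite X" "\<And>b. b \<in> X \<Longrightarrow> T b = T' b"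
  shows "reading_word X T = reading_word X T'"
  unfolding reading_word_def
proof (intro arg_cong[of _ _ concat] map_cong refl)
  fix i j assume "j \<in> set (rev (sorted_list_of_set {j. (i, j) \<in> X}))"
  moreover have "finite {j. (i, j) \<in> X}"
    using finite_cols[OF assms(1)] by (simp add: cols_def)
  ultimately show "T (i, j) = T' (i, j)" using assms(2) by simp
qed

lemma ssyt_restrict:
  assumes "ssyt X T" "Y \<subseteq> X"
  shows "ssyt Y (restrict_tab Y T)"
  using assms unfolding ssyt_def restrict_tab_def by (auto simp: subset_iff)

lemma psize_fcontent:
  assumes "finite X" "ssyt X T"
  shows "psize (fcontent X T) = card X" "finite {i. fcontent X T i \<noteq> 0}"
proof -
  obtain N where N: "\<forall>b\<in>X. T b \<le> N"
    using finite_nat_set_iff_bounded_le[of "T ` X"] assms(1) by auto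
  have zero: "fcontent X T i = 0" if "N \<le> i" for i
  proof -
    have "{b \<in> X. T b = Suc i} = {}" using N that by force
    then show ?thesis by (simp only: fcontent_def card.empty)
  qed
  have "X = (\<Union>i<N. {b \<in> X. T b = Suc i})"
  proof
    show "X \<subseteq> (\<Union>i<N. {b \<in> X. T b = Suc i})"
    proof
      fix b assume b: "b \<in> X"
      then have "0 < T b" "T b \<le> N" using N ssyt_pos[OF assms(2)] by auto
      then obtain i where "T b = Suc i" "i < N" by (cases "T b") auto
      then show "b \<in> (\<Union>i<N. {b \<in> X. T b = Suc i})" using b by blast
    qed
  qed blast
  then have "card X = card (\<Union>i<N. {b \<in> X. T b = Suc i})" by simp
  also have "\<dots> = (\<Sum>i<N. card {b \<in> X. T b = Suc i})"
    using assms(1) by (intro card_UN_disjoint) auto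
  also have "\<dots> = psize (fcontent X T)"
    using psize_eq[of N "fcontent X T", OF zero] by (simp add: fcontent_def)
  finally show "psize (fcontent X T) = card X" ..
  have "i < N" if "fcontent X T i \<noteq> 0" for i
    using zero[of i] that by (meson not_le)
  then have "{i. fcontent X T i \<noteq> 0} \<subseteq> {..<N}" by auto
  then show "finite {i. fcontent X T i \<noteq> 0}" by (rule finite_subset) simp
qed

lemma card_above_Suc: "finite X \<Longrightarrow> card (above X (Suc r)) = card (above X r) + card (cols X r)"
proof -
  assume "finite X"
  moreover have "above X r \<inter> {r} \<times> cols X r = {}" by (auto simp: above_def)
  ultimately show ?thesis
    unfolding above_Suc by (subst card_Un_disjoint) (auto simp: finite_above finite_cols card_cartesian_product_singleton)
qed

lemma sum_list_row_sizes: "finite X \<Longrightarrow> sum_list (row_sizes X r) = card (above X r)"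
  by (induction r) (simp_all add: row_sizes_simps above_0 card_above_Suc)

text \<open>Contents can only grow when a row is added, and the lattice condition bounds part
  \<open>i + 1\<close> of the new content by part \<open>i\<close> of the old one. Together this is
  interlacing, and it also makes the old content a partition.\<close>

lemma restrict_lr_tableaux:
  assumes "finite X" "c \<in> parts" and T: "T \<in> lr_tableaux (above X (Suc r)) c"
  defines "T' \<equiv> restrict_tab (above X r) T"
  shows "hstrip (card (cols X r)) (fcontent (above X r) T') c"
    "T' \<in> lr_tableaux (above X r) (fcontent (above X r) T')"
proof -
  have ss: "ssyt (above X (Suc r)) T" and c: "fcontent (above X (Suc r)) T = c"
    and lat: "lattice_word (reading_word (above X (Suc r)) T)"
    using T by (auto simp: lr_tableaux_def)
  have eq: "T' b = T b" if "b \<in> above X r" for b using that by (simp add: T'_def restrict_tab_def)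
  have fc: "fcontent (above X r) T' = fcontent (above X r) T" by (rule fcontent_cong) (rule eq)
  have ss': "ssyt (above X r) T'"
    unfolding T'_def by (rule ssyt_restrict[OF ss]) (auto simp: above_Suc)
  have down: "c (Suc i) \<le> fcontent (above X r) T' i" for i
    using lat lattice_above_Suc[OF assms(1) ssyt_above_row[OF ss]] by (simp add: fc c)
  have up: "fcontent (above X r) T' i \<le> c i" for i
    using fcontent_above_Suc[OF assms(1), of r T i] by (simp add: c fc)
  obtain N where N: "\<And>i. N \<le> i \<Longrightarrow> c i = 0" using assms(2) by (rule partsE) blast
  have "fcontent (above X r) T' i = 0" if "N \<le> i" for i using up[of i] N[OF that] by simp
  moreover have "fcontent (above X r) T' (Suc i) \<le> fcontent (above X r) T' i" for i
    using up[of "Suc i"] down[of i] by simp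
  ultimately have parts: "fcontent (above X r) T' \<in> parts" by (intro partsI[of _ N])
  have "psize c = psize (fcontent (above X r) T') + card (cols X r)"
    using psize_fcontent(1)[OF finite_above[OF assms(1)] ss] psize_fcontent(1)[OF finite_above[OF assms(1)] ss']
    by (simp add: c card_above_Suc[OF assms(1)])
  then show "hstrip (card (cols X r)) (fcontent (above X r) T') c"
    unfolding hstrip_def using assms(2) parts up down by blast
  have "lattice_word (reading_word (above X r) T')"
    using lat lattice_above_Suc[OF assms(1) ssyt_above_row[OF ss]] reading_word_cong[OF finite_above[OF assms(1)] eq] by simp
  then show "T' \<in> lr_tableaux (above X r) (fcontent (above X r) T')"
    using ss' by (simp add: lr_tableaux_def)
qed

text \<open>The difference of the contents gives the multiset of entries in the last row, and a
  weakly increasing row is determined by that multiset.\<close>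

lemma lr_tableaux_row_unique:
  assumes "finite X" "T \<in> lr_tableaux (above X (Suc r)) c" "T' \<in> lr_tableaux (above X (Suc r)) c"
    and eq: "restrict_tab (above X r) T = restrict_tab (above X r) T'"
  shows "T = T'"
proof -
  have ss: "ssyt (above X (Suc r)) T" "ssyt (above X (Suc r)) T'"
    and c: "fcontent (above X (Suc r)) T = fcontent (above X (Suc r)) T'"
    using assms(2,3) by (auto simp: lr_tableaux_def)
  have below: "T b = T' b" if "b \<in> above X r" for b
    using fun_cong[OF eq, of b] that by (simp add: restrict_tab_def)
  have sorted: "sorted (rev (row_word X S r))" if "ssyt (above X (Suc r)) S" for S
    by (rule sorted_row_word[OF assms(1) ssyt_above_row[OF that]])
  have pos: "0 \<notin> set (row_word X S r)" if "ssyt (above X (Suc r)) S" for S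
    using ssyt_pos[OF that] finite_cols[OF assms(1)] by (fastforce simp: row_word_def above_Suc)
  have "count_list (row_word X T r) v = count_list (row_word X T' r) v" for v
  proof (cases v)
    case 0
    then show ?thesis using pos ss by (simp add: count_list_0_iff)
  next
    case (Suc i)
    have "fcontent (above X r) T = fcontent (above X r) T'" by (rule fcontent_cong) (rule below)
    then show ?thesis
      using fcontent_above_Suc[OF assms(1), of r T i] fcontent_above_Suc[OF assms(1), of r T' i] c Suc
      by (simp add: count_row_word[OF assms(1)])
  qed
  then have "mset (row_word X T r) = mset (row_word X T' r)"
    by (simp add: multiset_eq_iff count_mset)
  then have "rev (row_word X T r) = rev (row_word X T' r)"
    using sorted ss by (metis mset_rev properties_for_sort)
  then have "map (\<lambda>j. T (r, j)) (sorted_list_of_set (cols X r)) = map (\<lambda>j. T' (r, j)) (sorted_list_of_set (cols X r))"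
    by (simp add: row_word_def)
  then have row: "T (r, j) = T' (r, j)" if "j \<in> cols X r" for j
    using that finite_cols[OF assms(1)] by simp
  show ?thesis
  proof
    fix b
    show "T b = T' b"
    proof (cases "b \<in> above X (Suc r)")
      case True
      then show ?thesis using below[of b] row by (auto simp: above_Suc)
    next
      case False
      then show ?thesis using ssyt_outside ss by metis
    qed
  qed
qed

text \<open>The new row receives \<open>c i - rho i\<close> copies of \<open>i + 1\<close> in
  increasing order; interlacing of \<open>rho\<close> and \<open>c\<close> is then the lattice
  condition.\<close>

lemma extend_lr_tableaux:
  assumes "finite X" "horizontal_strip X"
    and strip: "hstrip (card (cols X r)) rho c" and T': "T' \<in> lr_tableaux (above X r) rho"
  obtains T where "T \<in> lr_tableaux (above X (Suc r)) c" "restrict_tab (above X r) T = T'"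
proof -
  have ss': "ssyt (above X r) T'" and rho: "fcontent (above X r) T' = rho"
    and lat': "lattice_word (reading_word (above X r) T')"
    using T' by (auto simp: lr_tableaux_def)
  have p: "c \<in> parts" "rho \<in> parts" "\<And>i. rho i \<le> c i" "\<And>i. c (Suc i) \<le> rho i"
    "psize c = psize rho + card (cols X r)"
    using strip by (auto simp: hstrip_def)
  define de where "de i = c i - rho i" for i
  have de: "rho i + de i = c i" for i using p(3) by (simp add: de_def)
  have finde: "finite {i. de i \<noteq> 0}"
    by (rule finite_subset[of _ "{i. c i \<noteq> 0}"]) (use p(1) in \<open>auto simp: de_def parts_def\<close>)
  have "psize (\<lambda>i. rho i + de i) = psize rho + psize de"
    by (rule psize_add[OF _ finde]) (use p(2) in \<open>simp only: parts_def mem_Collect_eq\<close>)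
  then have psize_de: "psize de = card (cols X r)" using p(5) by (simp add: de)
  obtain g where g: "\<And>j. j \<in> cols X r \<Longrightarrow> 0 < g j" "\<And>j. j \<notin> cols X r \<Longrightarrow> g j = 0"
    "\<And>j j'. j \<in> cols X r \<Longrightarrow> j' \<in> cols X r \<Longrightarrow> j \<le> j' \<Longrightarrow> g j \<le> g j'"
    "\<And>k. card {j \<in> cols X r. g j = Suc k} = de k"
    by (rule ex_row_filling[OF finite_cols[OF assms(1)] finde psize_de]) blast
  define T where "T b = (if fst b = r then g (snd b) else T' b)" for b
  have old: "T b = T' b" if "b \<in> above X r" for b
    using that by (auto simp: T_def above_def)
  have new: "T (r, j) = g j" for j by (simp add: T_def)
  \<comment> \<open>This is where the shape enters: no column has two boxes, so column strictness
    holds vacuously.\<close>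
  have unique_row: "i = i'" if "(i, j) \<in> above X (Suc r)" "(i', j) \<in> above X (Suc r)" for i i' j
    using assms(2) that by (auto simp: horizontal_strip_def above_def)
  have ss: "ssyt (above X (Suc r)) T"
    unfolding ssyt_def
  proof (intro conjI allI ballI impI; (elim conjE)?)
    fix b assume "b \<in> above X (Suc r)"
    then show "0 < T b" using ssyt_pos[OF ss', of b] g(1) old[of b] new by (auto simp: above_Suc)
  next
    fix b assume b: "b \<notin> above X (Suc r)"
    show "T b = 0"
    proof (cases "fst b = r")
      case True
      then have "snd b \<notin> cols X r" using b by (cases b) (auto simp: above_Suc)
      then show ?thesis using True g(2) by (simp add: T_def)
    next
      case False
      then show ?thesis using b ssyt_outside[OF ss', of b] by (simp add: T_def above_Suc)
    qed
  next
    fix i j j' assume *: "(i, j) \<in> above X (Suc r)" "(i, j') \<in> above X (Suc r)" "j < j'"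
    show "T (i, j) \<le> T (i, j')"
    proof (cases "i = r")
      case True
      then have "j \<in> cols X r" "j' \<in> cols X r" using * by (auto simp: above_def cols_def)
      then show ?thesis using True g(3) * by (simp add: new)
    next
      case False
      then have "(i, j) \<in> above X r" "(i, j') \<in> above X r" using * by (auto simp: above_Suc)
      then show ?thesis using * ssyt_row[OF ss'] by (simp add: old)
    qed
  next
    fix i i' j assume "(i, j) \<in> above X (Suc r)" "(i', j) \<in> above X (Suc r)" "i < i'"
    then show "T (i, j) < T (i', j)" using unique_row by blast
  qed
  have fc: "fcontent (above X r) T = rho" using fcontent_cong[of "above X r" T T'] old rho by simp
  have c: "fcontent (above X (Suc r)) T = c"
    using fcontent_above_Suc[OF assms(1), of r T] by (auto simp: fc new g(4) de)
  have "reading_word (above X r) T = reading_word (above X r) T'"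
    by (rule reading_word_cong[OF finite_above[OF assms(1)]]) (rule old)
  then have "lattice_word (reading_word (above X (Suc r)) T)"
    unfolding lattice_above_Suc[OF assms(1) ssyt_above_row[OF ss]] using lat' p(4) by (simp add: c fc)
  then have "T \<in> lr_tableaux (above X (Suc r)) c" using ss c by (simp add: lr_tableaux_def)
  moreover have "restrict_tab (above X r) T = T'"
  proof
    fix b show "restrict_tab (above X r) T b = T' b"
      using old[of b] ssyt_outside[OF ss', of b] by (simp add: restrict_tab_def)
  qed
  ultimately show ?thesis by (rule that)
qed

lemma finite_lr_tableaux:
  assumes "finite X" "c \<in> parts"
  shows "finite (lr_tableaux X c)"
proof -
  have "c \<in> parts_of_size (psize c)" using assms(2) by (simp add: parts_of_size_def)
  then obtain mu where "c = row_fun mu"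
    using bij_betw_row_fun[of "psize c"] by (auto simp: bij_betw_def)
  then show ?thesis
    using finite_tableaux[OF assms(1), of mu] by (auto simp: lr_tableaux_def elim: rev_finite_subset)
qed

lemma card_lr_tableaux:
  assumes "finite X" "horizontal_strip X"
  shows "c \<in> parts \<Longrightarrow> card (lr_tableaux (above X r) c) = strip_chains (row_sizes X r) c"
proof (induction r arbitrary: c)
  case 0
  have "lr_tableaux (above X 0) c = (if c = (\<lambda>_. 0) then {\<lambda>_. 0} else {})"
    by (auto simp: lr_tableaux_def above_0 ssyt_def fcontent_def reading_word_def lattice_word_def)
  then show ?case by (simp add: row_sizes_simps)
next
  case (Suc r)
  \<comment> \<open>The content of the filling without its last row is the preceding partition of
    the chain.\<close>
  let ?F = "\<lambda>T. (fcontent (above X r) (restrict_tab (above X r) T), restrict_tab (above X r) T)"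
  let ?S = "SIGMA rho:{rho. hstrip (card (cols X r)) rho c}. lr_tableaux (above X r) rho"
  have "bij_betw ?F (lr_tableaux (above X (Suc r)) c) ?S"
  proof (rule bij_betw_imageI)
    show "inj_on ?F (lr_tableaux (above X (Suc r)) c)"
      by (rule inj_onI) (use lr_tableaux_row_unique[OF assms(1)] in blast)
    show "?F ` lr_tableaux (above X (Suc r)) c = ?S"
    proof
      show "?F ` lr_tableaux (above X (Suc r)) c \<subseteq> ?S"
        using restrict_lr_tableaux[OF assms(1) Suc.prems] by blast
      show "?S \<subseteq> ?F ` lr_tableaux (above X (Suc r)) c"
      proof clarify
        fix rho T' assume T': "hstrip (card (cols X r)) rho c" "T' \<in> lr_tableaux (above X r) rho"
        obtain T where "T \<in> lr_tableaux (above X (Suc r)) c" "restrict_tab (above X r) T = T'"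
          using extend_lr_tableaux[OF assms T'] .
        moreover have "fcontent (above X r) T' = rho" using T' by (simp add: lr_tableaux_def)
        ultimately show "(rho, T') \<in> ?F ` lr_tableaux (above X (Suc r)) c"
          by (intro image_eqI[of _ _ T]) auto
      qed
    qed
  qed
  then have "card (lr_tableaux (above X (Suc r)) c) = card ?S" by (rule bij_betw_same_card)
  also have "\<dots> = (\<Sum>rho | hstrip (card (cols X r)) rho c. card (lr_tableaux (above X r) rho))"
    by (rule card_SigmaI[OF finite_hstrip_down]) (auto simp: hstrip_def intro!: finite_lr_tableaux finite_above assms)
  also have "\<dots> = (\<Sum>rho | hstrip (card (cols X r)) rho c. strip_chains (row_sizes X r) rho)"
    by (intro sum.cong refl Suc.IH) (auto simp: hstrip_def)
  finally show ?case by (simp add: row_sizes_simps)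
qed

lemma lr_coeff_eq_card:
  assumes "finite X" "\<forall>r\<in>set nu. 0 < r"
  shows "lr_coeff X nu = card (lr_tableaux X (row_fun nu))"
  unfolding lr_coeff_def lr_tableaux_def by (simp add: ssyt_content_eq_iff[OF assms])


section \<open>Skew Schur functions\<close>

text \<open>Each monomial occurs in exactly one monomial symmetric function, that of its sorted
  exponents. Evaluating at \<open>a\<close> thus selects a single term of an expansion in these
  functions.\<close>

lemma ex_exponent_partition:
  obtains js where "distinct js" "set js = Poly_Mapping.keys a"
    "map (exponent a) js \<in> partitions_of (mdeg a)"
    "\<forall>mu. is_partition mu \<longrightarrow> monomial_sym mu a = (if mu = map (exponent a) js then 1 else 0)"
proof -
  define js where "js = rev (sort_key (exponent a) (sorted_list_of_set (Poly_Mapping.keys a)))"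
  have js: "distinct js" "set js = Poly_Mapping.keys a"
    by (simp_all add: js_def)
  have sorted: "sorted (rev (map (exponent a) js))"
    by (simp add: js_def rev_map)
  have pos: "\<forall>r\<in>set (map (exponent a) js). 0 < r"
    using js by (auto simp: in_keys_iff)
  have part: "is_partition (map (exponent a) js)"
    using sorted pos by (simp add: is_partition_def sorted_wrt_rev)
  have "monomial_sym mu a = (if mu = map (exponent a) js then 1 else 0)" if mu: "is_partition mu" for mu
  proof -
    have "(\<exists>js'. length js' = length mu \<and> distinct js' \<and> a = monom_of js' mu) \<longleftrightarrow> mu = map (exponent a) js"
    proof
      assume "\<exists>js'. length js' = length mu \<and> distinct js' \<and> a = monom_of js' mu"
      then obtain js' where js': "length js' = length mu" "distinct js'" "a = monom_of js' mu" by blast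
      have map: "map (exponent a) js' = mu" using js' by (simp add: map_monom_of)
      have "set js' = Poly_Mapping.keys a"
      proof
        show "set js' \<subseteq> Poly_Mapping.keys a"
        proof
          fix x assume "x \<in> set js'"
          then have "exponent a x \<in> set mu" using map by auto
          then show "x \<in> Poly_Mapping.keys a" using mu by (auto simp: is_partition_def in_keys_iff)
        qed
        show "Poly_Mapping.keys a \<subseteq> set js'"
        proof
          fix x assume "x \<in> Poly_Mapping.keys a"
          then show "x \<in> set js'"
            using monom_of_eq_0[of x js' mu] js' by (cases "x \<in> set js'") (auto simp: in_keys_iff)
        qed
      qed
      \<comment> \<open>Any other list of variables that represents \<open>a\<close> is a
        permutation of \<open>js\<close>; both exponent lists are sorted, hence equal.\<close>
      then have "mset js' = mset js"
        using js js'(2) set_eq_iff_mset_eq_distinct by metis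
      then have "mset (rev mu) = mset (rev (map (exponent a) js))"
        using map by (metis mset_map mset_rev)
      moreover have "sorted (rev mu)" using mu by (simp add: is_partition_def sorted_wrt_rev)
      ultimately have "rev mu = rev (map (exponent a) js)"
        using sorted by (metis properties_for_sort)
      then show "mu = map (exponent a) js" by simp
    next
      assume mu: "mu = map (exponent a) js"
      have "monom_of js (map (exponent a) js) = a"
        by (rule monom_of_map) (use js in auto)
      then show "\<exists>js'. length js' = length mu \<and> distinct js' \<and> a = monom_of js' mu"
        using js mu by (intro exI[of _ js]) auto
    qed
    then show ?thesis by (simp only: monomial_sym_def monom_of_def)
  qed
  moreover have "map (exponent a) js \<in> partitions_of (mdeg a)"
    using part mdeg_map[of js a] js by (simp add: partitions_of_def)
  ultimately show ?thesis using js that by blast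
qed

lemma monomial_sym_eq_0:
  assumes "mdeg a \<noteq> sum_list mu"
  shows "monomial_sym mu a = 0"
proof -
  have "a \<noteq> (\<Sum>k<length mu. Poly_Mapping.single (js ! k) (mu ! k))" for js
    using assms by (auto simp: mdeg_sum sum_list_sum_nth atLeast0LessThan)
  then show ?thesis by (simp only: monomial_sym_def) simp
qed

lemma schur_eq_kostka:
  assumes "la \<in> partitions_of n" "mu \<in> partitions_of n"
    and "\<forall>ka. is_partition ka \<longrightarrow> monomial_sym ka a = (if ka = mu then 1 else 0)"
  shows "schur la a = of_nat (kostka la mu)"
proof -
  have "schur la a = (\<Sum>ka\<in>partitions_of n. if ka = mu then of_nat (kostka la ka) else 0)"
    unfolding schur_def using assms(1,3) by (intro sum.cong) (auto simp: partitions_of_def)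
  then show ?thesis using assms(2) finite_partitions_of by simp
qed

lemma skew_schur_eq:
  assumes "mu \<in> partitions_of (card X)"
    and "\<forall>ka. is_partition ka \<longrightarrow> monomial_sym ka a = (if ka = mu then 1 else 0)"
  shows "skew_schur X a = of_nat (\<Sum>nu\<in>partitions_of (card X). lr_coeff X nu * kostka nu mu)"
  unfolding skew_schur_def of_nat_sum of_nat_mult
  by (intro sum.cong refl) (simp add: schur_eq_kostka[OF _ assms])

lemma skew_schur_eq_0:
  assumes "mdeg a \<noteq> card X"
  shows "skew_schur X a = 0"
  unfolding skew_schur_def schur_def
  by (intro sum.neutral ballI) (use assms in \<open>simp add: partitions_of_def monomial_sym_eq_0\<close>)

text \<open>The coefficient counts pairs of a Littlewood-Richardson filling of \<open>X\<close> and
  a tableau whose shape is the content of that filling. Both are chains ending in this partition, so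
  the count is a \<open>strip_pairing\<close>.\<close>

lemma skew_schur_horizontal_strip:
  assumes "finite X" "horizontal_strip X" "above X r = X"
  shows "skew_schur X = hom_sym_list (row_sizes X r)"
proof
  fix a
  let ?al = "row_sizes X r"
  have sum_al: "sum_list ?al = card X"
    using sum_list_row_sizes[OF assms(1), of r] assms(3) by simp
  show "skew_schur X a = hom_sym_list ?al a"
  proof (cases "mdeg a = card X")
    case False
    then show ?thesis using sum_al by (simp add: skew_schur_eq_0 hom_sym_list_eq_0)
  next
    case True
    obtain js where js: "distinct js" "set js = Poly_Mapping.keys a"
      "map (exponent a) js \<in> partitions_of (card X)"
      "\<forall>mu. is_partition mu \<longrightarrow> monomial_sym mu a = (if mu = map (exponent a) js then 1 else 0)"
      using ex_exponent_partition[of a] True by metis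
    let ?mu = "map (exponent a) js"
    have pos: "\<forall>r\<in>set nu. 0 < r" if "nu \<in> partitions_of n" for nu n
      using that by (simp add: partitions_of_def is_partition_def)
    \<comment> \<open>The reversal in \<open>card_tableaux\<close> is absorbed by listing the
      variables in the order \<open>rev js\<close>, as \<open>strip_pairing_eq_hom_sym\<close>
      allows any order.\<close>
    have "lr_coeff X nu * kostka nu ?mu =
        strip_chains ?al (row_fun nu) * strip_chains (map (exponent a) (rev js)) (row_fun nu)"
      if nu: "nu \<in> partitions_of (card X)" for nu
    proof -
      have p: "row_fun nu \<in> parts" using row_fun_parts[OF nu] by (simp add: parts_of_size_def)
      show ?thesis
        using card_lr_tableaux[OF assms(1,2) p, of r] lr_coeff_eq_card[OF assms(1) pos[OF nu]]
          card_tableaux[OF p, of ?mu] kostka_eq_card[OF pos[OF js(3)], of nu]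
        by (simp add: assms(3) rev_map)
    qed
    then have "skew_schur X a = of_nat (\<Sum>nu\<in>partitions_of (card X).
        strip_chains ?al (row_fun nu) * strip_chains (map (exponent a) (rev js)) (row_fun nu))"
      unfolding skew_schur_eq[OF js(3,4)] by (intro arg_cong[of _ _ of_nat] sum.cong refl)
    also have "\<dots> = of_nat (\<Sum>f\<in>parts_of_size (card X).
        strip_chains ?al f * strip_chains (map (exponent a) (rev js)) f)"
      by (rule arg_cong[OF sum.reindex_bij_betw[OF bij_betw_row_fun]])
    also have "\<dots> = of_nat (strip_pairing ?al (map (exponent a) (rev js)))"
      using js(3) by (simp add: strip_pairing_def partitions_of_def flip: rev_map)
    also have "\<dots> = hom_sym_list ?al a"
      by (rule strip_pairing_eq_hom_sym) (use js in auto)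
    finally show ?thesis .
  qed
qed

section \<open>A Littlewood-Richardson filling of an arbitrary skew diagram\<close>

definition column_tab :: "(nat \<times> nat) set \<Rightarrow> nat \<times> nat \<Rightarrow> nat" where
  "column_tab X b = (if b \<in> X then card {i. i \<le> fst b \<and> (i, snd b) \<in> X} else 0)"

lemma ssyt_column_tab:
  assumes "skew_diagram X"
  shows "ssyt X (column_tab X)"
proof -
  obtain la mu where la: "is_partition la" and mu: "is_partition mu" and X: "X = diagram la - diagram mu"
    using assms by (auto simp: skew_diagram_def)
  have anti: "ka ! i' \<le> ka ! i" if "is_partition ka" "i \<le> i'" "i' < length ka" for ka i i'
    using that by (cases "i = i'") (auto simp: is_partition_def intro: sorted_wrt_nth_less)
  \<comment> \<open>The upper right corner of a rectangle belongs to \<open>X\<close> if the lower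
    right and upper left corners do. Boxes above a given one therefore have counterparts in every
    later column of its row, so the numbering increases weakly along rows.\<close>
  have convex: "(i', j') \<in> X" if "(i, j') \<in> X" "(i', j) \<in> X" "i' \<le> i" "j \<le> j'" for i i' j j'
  proof -
    have "(i', j') \<in> diagram la"
      using that anti[OF la, of i' i] by (auto simp: X diagram_def)
    moreover have "(i', j') \<notin> diagram mu"
      using that by (auto simp: X diagram_def)
    ultimately show ?thesis by (simp add: X)
  qed
  show ?thesis
    unfolding ssyt_def
  proof (intro conjI allI ballI impI; (elim conjE)?)
    fix b assume b: "b \<in> X"
    then have "fst b \<in> {i. i \<le> fst b \<and> (i, snd b) \<in> X}" by simp
    then show "0 < column_tab X b"
      using b by (auto simp: column_tab_def card_gt_0_iff)
  next
    fix b assume "b \<notin> X" then show "column_tab X b = 0" by (simp add: column_tab_def)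
  next
    fix i j j' assume "(i, j) \<in> X" "(i, j') \<in> X" "j < j'"
    then show "column_tab X (i, j) \<le> column_tab X (i, j')"
      using convex[of i j' _ j] by (auto simp: column_tab_def intro!: card_mono)
  next
    fix i i' j assume *: "(i, j) \<in> X" "(i', j) \<in> X" "i < i'"
    have "i' \<in> {k. k \<le> i' \<and> (k, j) \<in> X} - {k. k \<le> i \<and> (k, j) \<in> X}"
      using * by simp
    moreover have "{k. k \<le> i \<and> (k, j) \<in> X} \<subseteq> {k. k \<le> i' \<and> (k, j) \<in> X}"
      using *(3) by auto
    ultimately have "{k. k \<le> i \<and> (k, j) \<in> X} \<subset> {k. k \<le> i' \<and> (k, j) \<in> X}"
      by blast
    then show "column_tab X (i, j) < column_tab X (i', j)"
      using * by (auto simp: column_tab_def intro!: psubset_card_mono)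
  qed
qed

text \<open>Every entry \<open>i + 2\<close> has an \<open>i + 1\<close> in the same column and a
  higher row, which is read earlier. A value occurs at most once per column, so comparing columns
  compares the counts.\<close>

lemma lattice_column_tab:
  assumes "finite X" "ssyt X (column_tab X)"
  shows "lattice_word (reading_word (above X r) (column_tab X))"
proof (induction r)
  case 0
  then show ?case by (simp add: above_0 reading_word_def lattice_word_def)
next
  case (Suc r)
  let ?T = "column_tab X"
  have "fcontent (above X (Suc r)) ?T (Suc i) \<le> fcontent (above X r) ?T i" for i
  proof -
    let ?A = "{b \<in> above X (Suc r). ?T b = Suc (Suc i)}"
    let ?B = "{b \<in> above X r. ?T b = Suc i}"
    have "inj_on snd ?A"
    proof (rule inj_onI)
      fix b b' assume *: "b \<in> ?A" "b' \<in> ?A" "snd b = snd b'"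
      obtain k k' j where k: "b = (k, j)" "b' = (k', j)" using *(3) by (cases b, cases b') auto
      have "(k, j) \<in> X" "(k', j) \<in> X" "?T (k, j) = ?T (k', j)" using * by (auto simp: k above_def)
      then show "b = b'"
        using ssyt_col[OF assms(2), of k j k'] ssyt_col[OF assms(2), of k' j k] k
        by (metis less_irrefl linorder_neqE_nat)
    qed
    then have "card ?A = card (snd ` ?A)" by (rule card_image[symmetric])
    also have "\<dots> \<le> card (snd ` ?B)"
    proof (rule card_mono)
      show "finite (snd ` ?B)" using finite_above[OF assms(1)] by simp
      show "snd ` ?A \<subseteq> snd ` ?B"
      proof clarify
        fix k j assume kj: "(k, j) \<in> above X (Suc r)" "?T (k, j) = Suc (Suc i)"
        let ?C = "{k'. k' \<le> k \<and> (k', j) \<in> X}"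
        have kX: "(k, j) \<in> X" "k \<le> r" using kj by (auto simp: above_def)
        then have C: "card ?C = Suc (Suc i)" using kj(2) by (simp add: column_tab_def)
        have finC: "finite ?C" by simp
        have card: "card (?C - {k}) = Suc i" using C kX by simp
        then have ne: "?C - {k} \<noteq> {}" by (metis card.empty nat.distinct(1))
        \<comment> \<open>The row of the nearest box above \<open>k\<close> in column
          \<open>j\<close>; its entry is smaller by one.\<close>
        define m where "m = Max (?C - {k})"
        have m: "m \<in> ?C - {k}" unfolding m_def using finC ne by (intro Max_in) auto
        have ge: "x \<le> m" if "x \<in> ?C - {k}" for x unfolding m_def using finC that by (intro Max_ge) auto
        have "{k'. k' \<le> m \<and> (k', j) \<in> X} = ?C - {k}"
          using m ge by fastforce
        then have "?T (m, j) = Suc i" using m card by (simp add: column_tab_def)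
        moreover have "(m, j) \<in> above X r" using m kX by (auto simp: above_def)
        ultimately have "(m, j) \<in> ?B" by simp
        then show "snd (k, j) \<in> snd ` ?B" by (metis image_eqI snd_conv)
      qed
    qed
    also have "\<dots> \<le> card ?B" by (rule card_image_le) (simp add: finite_above[OF assms(1)])
    finally show ?thesis by (simp add: fcontent_def)
  qed
  moreover have row: "\<forall>j\<in>cols X r. \<forall>j'\<in>cols X r. j \<le> j' \<longrightarrow> ?T (r, j) \<le> ?T (r, j')"
    using ssyt_row[OF assms(2)] by (simp add: cols_def)
  ultimately show ?case unfolding lattice_above_Suc[OF assms(1) row] using Suc by blast
qed

text \<open>The witness is the content of \<open>column_tab X\<close>, which is weakly decreasing by
  the lattice condition for the complete reading word.\<close>

lemma ex_lr_coeff_pos: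
  assumes "skew_diagram X"
  obtains nu where "nu \<in> partitions_of (card X)" "0 < lr_coeff X nu"
proof -
  let ?T = "column_tab X"
  have fin: "finite X" by (rule finite_skew_diagram) fact
  note ss = ssyt_column_tab[OF assms]
  obtain r where r: "above X r = X" using ex_above_eq[OF fin] .
  have lat: "lattice_word (reading_word X ?T)" using lattice_column_tab[OF fin ss, of r] r by simp
  obtain N where N: "\<And>i. N \<le> i \<Longrightarrow> fcontent X ?T i = 0"
    using ex_zero_beyond[OF psize_fcontent(2)[OF fin ss]] by blast
  have "fcontent X ?T (Suc i) \<le> fcontent X ?T i" for i
    using lat[unfolded lattice_word_def, rule_format, of "length (reading_word X ?T)" "Suc i"]
      count_reading_word_above[OF fin, of r ?T] r by simp
  then have p: "fcontent X ?T \<in> parts" using N by (intro partsI[of _ N])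
  then have "fcontent X ?T \<in> parts_of_size (card X)"
    using psize_fcontent(1)[OF fin ss] by (simp add: parts_of_size_def)
  then obtain nu where nu: "nu \<in> partitions_of (card X)" "row_fun nu = fcontent X ?T"
    using bij_betw_row_fun[of "card X"] by (metis bij_betw_def imageE)
  have "?T \<in> lr_tableaux X (row_fun nu)" using ss lat nu(2) by (simp add: lr_tableaux_def)
  moreover have "finite (lr_tableaux X (row_fun nu))"
    unfolding nu(2) by (rule finite_lr_tableaux[OF fin p])
  ultimately have "0 < card (lr_tableaux X (row_fun nu))"
    by (auto simp: card_gt_0_iff)
  then have "0 < lr_coeff X nu"
    using nu(1) lr_coeff_eq_card[OF fin, of nu] by (simp add: partitions_of_def is_partition_def)
  then show ?thesis using nu(1) that by blast
qed

lemma kostka_self_pos: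
  assumes "nu \<in> partitions_of n"
  shows "0 < kostka nu nu"
proof -
  let ?f = "row_fun nu"
  \<comment> \<open>The tableau with all entries of row \<open>i\<close> equal to
    \<open>i + 1\<close>.\<close>
  define T where "T b = (if b \<in> ydiag ?f then Suc (fst b) else 0)" for b
  have p: "?f \<in> parts" using row_fun_parts[OF assms] by (simp add: parts_of_size_def)
  have "ssyt (ydiag ?f) T" by (auto simp: ssyt_def T_def)
  moreover have "fcontent (ydiag ?f) T k = ?f k" for k
  proof -
    have "{b \<in> ydiag ?f. T b = Suc k} = {k} \<times> {..<?f k}"
      by (auto simp: T_def ydiag_def)
    then show ?thesis by (simp add: fcontent_def card_cartesian_product_singleton)
  qed
  ultimately have "T \<in> tableaux ?f nu" by (auto simp: tableaux_def)
  then have "0 < card (tableaux ?f nu)"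
    using finite_tableaux_ydiag[OF p] by (auto simp: card_gt_0_iff)
  then show ?thesis
    using assms kostka_eq_card[of nu nu] by (simp add: partitions_of_def is_partition_def)
qed

section \<open>Necessity: the coefficient of a power of one variable\<close>

lemma horizontal_strip_if_content_singleton:
  assumes "finite X" "ssyt X T" "ssyt_content X T = [n]" "0 < n"
  shows "horizontal_strip X"
proof -
  have "fcontent X T = row_fun [n]"
    using ssyt_content_eq_iff[OF assms(1), of "[n]" T] assms(3,4) by simp
  then have le: "T b \<le> 1" if "b \<in> X" for b
    using tableau_le_length[OF assms(1) _ that] by force
  have "\<not> i < i'" if "(i, j) \<in> X" "(i', j) \<in> X" for i i' j
    using ssyt_col[OF assms(2) that] ssyt_pos[OF assms(2) that(1)] le[OF that(2)] by auto
  then show ?thesis unfolding horizontal_strip_def by (metis linorder_neqE_nat)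
qed

text \<open>A nonzero term needs a tableau of shape \<open>nu\<close> filled with ones, which forces
  \<open>nu\<close> to be a single row; then \<open>X\<close> itself has a filling with ones and
  would be a horizontal strip.\<close>

lemma skew_schur_single_var:
  assumes "finite X" "\<not> horizontal_strip X"
  shows "skew_schur X (Poly_Mapping.single 0 (card X)) = 0"
proof -
  let ?n = "card X" and ?a = "Poly_Mapping.single 0 (card X) :: nat \<Rightarrow>\<^sub>0 nat"
  have "X \<noteq> {}" using assms(2) by (auto simp: horizontal_strip_def)
  then have n: "0 < ?n" using assms(1) by (simp add: card_gt_0_iff)
  obtain js where js: "map (exponent ?a) js \<in> partitions_of ?n"
    "\<forall>mu. is_partition mu \<longrightarrow> monomial_sym mu ?a = (if mu = map (exponent ?a) js then 1 else 0)"
    using ex_exponent_partition[of ?a] by (metis mdeg_single)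
  have "monomial_sym [?n] ?a = 1" by (auto simp: monomial_sym_single)
  moreover have "is_partition [?n]" using n by (simp add: is_partition_def)
  ultimately have mu: "map (exponent ?a) js = [?n]"
    using js(2) by (metis zero_neq_one)
  have "lr_coeff X nu * kostka nu [?n] = 0" if nu: "nu \<in> partitions_of ?n" for nu
  proof (rule ccontr)
    assume "lr_coeff X nu * kostka nu [?n] \<noteq> 0"
    then have "lr_coeff X nu \<noteq> 0" "kostka nu [?n] \<noteq> 0" by auto
    then obtain T T' where T: "ssyt X T" "ssyt_content X T = nu"
      "ssyt (diagram nu) T'" "ssyt_content (diagram nu) T' = [?n]"
      unfolding lr_coeff_def kostka_def by (metis (mono_tags, lifting) Collect_empty_eq card.empty)
    have strip: "horizontal_strip (diagram nu)"
      by (rule horizontal_strip_if_content_singleton[OF finite_diagram T(3,4) n])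
    have pos: "\<forall>r\<in>set nu. 0 < r" and sum: "sum_list nu = ?n"
      using nu by (auto simp: partitions_of_def is_partition_def)
    have "length nu \<le> 1"
    proof (rule ccontr)
      assume "\<not> length nu \<le> 1"
      then obtain x y ys where "nu = x # y # ys"
        by (auto simp: not_le Suc_le_length_iff simp flip: Suc_le_eq)
      then have "(0, 0) \<in> diagram nu" "(1, 0) \<in> diagram nu"
        using pos by (auto simp: diagram_def)
      then show False using strip unfolding horizontal_strip_def by (metis zero_neq_one)
    qed
    then have "nu = [?n]" using sum n by (cases nu) auto
    then have "horizontal_strip X"
      using horizontal_strip_if_content_singleton[OF assms(1) T(1) _ n] T(2) by simp
    then show False using assms(2) by simp
  qed
  then have "(\<Sum>nu\<in>partitions_of ?n. lr_coeff X nu * kostka nu [?n]) = 0"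
    by (intro sum.neutral ballI)
  then show ?thesis
    unfolding skew_schur_eq[OF js] mu by (simp only: of_nat_0)
qed

text \<open>The coefficient at the power of one variable is the sum of the nonnegative coefficients
  of degree \<open>n\<close>. If it is 0, they all vanish, and terms of other degrees do not reach
  \<open>a\<close>.\<close>

lemma p_positive_eq_0:
  assumes "p_positive f" "f (Poly_Mapping.single 0 n) = 0" "mdeg a = n"
  shows "f a = 0"
proof -
  obtain S c where f: "finite S" "\<And>la. la \<in> S \<Longrightarrow> is_partition la" "\<And>la. c la \<in> \<real>\<^sub>\<ge>\<^sub>0"
    "f = (\<lambda>a. \<Sum>la\<in>S. c la * power_sum la a)"
    using assms(1) by (rule p_positiveE) blast
  have pos: "\<forall>r\<in>set la. 0 < r" if "la \<in> S" for la
    using f(2)[OF that] by (simp add: is_partition_def)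
  have "power_sum la (Poly_Mapping.single 0 n) = (if sum_list la = n then 1 else 0)" if "la \<in> S" for la
    using power_sum_single_var[OF pos[OF that]] power_sum_eq_0[of "Poly_Mapping.single 0 n", OF _ pos[OF that]]
    by auto
  then have "f (Poly_Mapping.single 0 n) = (\<Sum>la\<in>S. c la * (if sum_list la = n then 1 else 0))"
    unfolding f(4) by (intro sum.cong) auto
  then have "(\<Sum>la\<in>S. c la * (if sum_list la = n then 1 else 0)) = 0"
    using assms(2) by simp
  then have "Re (\<Sum>la\<in>S. c la * (if sum_list la = n then 1 else 0)) = 0"
    by simp
  then have sum0: "(\<Sum>la\<in>S. if sum_list la = n then Re (c la) else 0) = 0"
    by (simp add: if_distrib cong: if_cong)
  have Re: "0 \<le> Re (c la)" "Im (c la) = 0" for la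
    using f(3)[of la] by (auto simp: complex_nonneg_Reals_iff)
  have "\<forall>la\<in>S. (if sum_list la = n then Re (c la) else 0) = 0"
    using sum0 Re by (subst (asm) sum_nonneg_eq_0_iff[OF f(1)]) auto
  then have "c la = 0" if "la \<in> S" "sum_list la = n" for la
    using that Re by (auto simp: complex_eq_iff)
  then have "c la * power_sum la a = 0" if "la \<in> S" for la
    using that power_sum_eq_0[of a la] pos[OF that] assms(3) by (cases "sum_list la = n") auto
  then show ?thesis unfolding f(4) by (intro sum.neutral ballI)
qed

theorem proposition2p6:
  fixes D :: "(nat \<times> nat) set"
  assumes "skew_diagram D"
  shows "p_positive (skew_schur D) \<longleftrightarrow> horizontal_strip D"
proof
  have fin: "finite D" by (rule finite_skew_diagram) fact
  show "p_positive (skew_schur D)" if "horizontal_strip D"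
  proof -
    obtain r where "above D r = D" using ex_above_eq[OF fin] .
    then show ?thesis
      using skew_schur_horizontal_strip[OF fin that] p_positive_hom_sym_list by simp
  qed
  show "horizontal_strip D" if pos: "p_positive (skew_schur D)"
  proof (rule ccontr)
    assume "\<not> horizontal_strip D"
    note zero = p_positive_eq_0[OF pos skew_schur_single_var[OF fin this]]
    obtain nu where nu: "nu \<in> partitions_of (card D)" "0 < lr_coeff D nu"
      using ex_lr_coeff_pos[OF assms] .
    \<comment> \<open>The monomial with exponent list \<open>nu\<close>: the term of
      \<open>nu\<close> contributes the positive number \<open>lr_coeff D nu * kostka nu nu\<close>
      to its coefficient, which nevertheless has to be 0 by \<open>zero\<close>.\<close>
    define a where "a = monom_of [0..<length nu] nu"
    obtain js where js: "map (exponent a) js \<in> partitions_of (mdeg a)"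
      "\<forall>mu. is_partition mu \<longrightarrow> monomial_sym mu a = (if mu = map (exponent a) js then 1 else 0)"
      using ex_exponent_partition[of a] by metis
    have "monomial_sym nu a = 1"
      unfolding monomial_sym_def a_def monom_of_def by (rule if_P) (intro exI[of _ "[0..<length nu]"], simp)
    then have mu: "map (exponent a) js = nu"
      using js(2) nu(1) by (metis (mono_tags, lifting) mem_Collect_eq partitions_of_def zero_neq_one)
    then have deg: "mdeg a = card D" using js(1) nu(1) by (simp add: partitions_of_def)
    have "(\<Sum>ka\<in>partitions_of (card D). lr_coeff D ka * kostka ka nu) = 0"
      using zero[OF deg] skew_schur_eq[OF nu(1) js(2)[unfolded mu]] by (simp del: of_nat_sum of_nat_mult sum_eq_0_iff)
    then have "lr_coeff D nu * kostka nu nu = 0"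
      using nu(1) finite_partitions_of by simp
    then show False using nu(2) kostka_self_pos[OF nu(1)] by simp
  qed
qed

end
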